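(* Let $s>0$. There exists a constant $C_s>0$ such that for all $f,\varphi\in L^2(\mathbb{R}^2,\mathbb{H})$, $$\|f\|_{L^2(\mathbb{R}^2,\mathbb{H})}\,\|\varphi\|_{L^2(\mathbb{R}^2,\mathbb{H})}\ \leq\ C_s\left(\int\int_{\mathbb{R}^2\times\mathbb{R}^2}|(\omega,b)|^{2s}\,|\mathcal{G}_{\varphi}\{f\}(\omega,b)|^2\,d\omega\,db\right)^{\frac12}$$ (the right-hand side may be $+\infty$).
   Context: $\mathbb{H}$ is the algebra of real quaternions with imaginary units $i,j,k$ ($i^2=j^2=k^2=ijk=-1$), conjugation $\overline{q}$ and modulus $|q|=\sqrt{q\overline{q}}$. $L^2(\mathbb{R}^2,\mathbb{H})$ is the space of measurable $f:\mathbb{R}^2\to\mathbb{H}$ with $\|f\|_{L^2(\mathbb{R}^2,\mathbb{H})}=\left(\int_{\mathbb{R}^2}|f(x)|^2dx\right)^{1/2}<\infty$. $|(\omega,b)|$ is the Euclidean norm of $(\omega,b)\in\mathbb{R}^2\times\mathbb{R}^2$. For $f,\varphi\in L^2(\mathbb{R}^2,\mathbb{H})$, the two-sided Gabor quaternion Fourier transform (GQFT) of $f$ with window $\varphi$ is $$\mathcal{G}_{\varphi}\{f\}(\omega,b)=\int_{\mathbb{R}^2}e^{-2\pi i x_1\omega_1}\,f(x)\,\overline{\varphi(x-b)}\,e^{-2\pi j x_2\omega_2}\,dx,\qquad \omega=(\omega_1,\omega_2),\ b\in\mathbb{R}^2.$$ *)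

theory Defs
  imports "HOL-Analysis.Analysis"
begin

section \<open>Quaternions\<close>

datatype quat = Quat (qRe: real) (qI: real) (qJ: real) (qK: real)

lemma quat_eq_iff:
  "x = y \<longleftrightarrow> qRe x = qRe y \<and> qI x = qI y \<and> qJ x = qJ y \<and> qK x = qK y"
  by (cases x; cases y) simp

instantiation quat :: ring_1
begin

definition "0 = Quat 0 0 0 0"

definition "1 = Quat 1 0 0 0"

definition "x + y = Quat (qRe x + qRe y) (qI x + qI y) (qJ x + qJ y) (qK x + qK y)"

definition "- x = Quat (- qRe x) (- qI x) (- qJ x) (- qK x)"

definition "x - y = Quat (qRe x - qRe y) (qI x - qI y) (qJ x - qJ y) (qK x - qK y)"

definition "x * y = Quat
  (qRe x * qRe y - qI x * qI y - qJ x * qJ y - qK x * qK y)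
  (qRe x * qI y + qI x * qRe y + qJ x * qK y - qK x * qJ y)
  (qRe x * qJ y - qI x * qK y + qJ x * qRe y + qK x * qI y)
  (qRe x * qK y + qI x * qJ y - qJ x * qI y + qK x * qRe y)"

instance
  by standard
    (simp_all add: quat_eq_iff zero_quat_def one_quat_def plus_quat_def uminus_quat_def
      minus_quat_def times_quat_def algebra_simps)

end

instantiation quat :: real_algebra_1
begin

definition "r *\<^sub>R x = Quat (r * qRe x) (r * qI x) (r * qJ x) (r * qK x)"

instance
  by standard
    (simp_all add: quat_eq_iff plus_quat_def times_quat_def scaleR_quat_def algebra_simps)

end

definition quat_i :: quat where "quat_i = Quat 0 1 0 0"

definition quat_j :: quat where "quat_j = Quat 0 0 1 0"

definition quat_k :: quat where "quat_k = Quat 0 0 0 1"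

definition quat_cnj :: "quat \<Rightarrow> quat" where
  "quat_cnj q = Quat (qRe q) (- qI q) (- qJ q) (- qK q)"

lemma quat_units:
  "quat_i * quat_i = - 1" "quat_j * quat_j = - 1" "quat_k * quat_k = - 1"
  "quat_i * quat_j * quat_k = - 1"
  by (simp_all add: quat_i_def quat_j_def quat_k_def times_quat_def one_quat_def uminus_quat_def)

lemma quat_expansion:
  "q = of_real (qRe q) + qI q *\<^sub>R quat_i + qJ q *\<^sub>R quat_j + qK q *\<^sub>R quat_k"
  by (simp add: quat_eq_iff of_real_def quat_i_def quat_j_def quat_k_def plus_quat_def
      one_quat_def scaleR_quat_def)

instantiation quat :: real_inner
begin

definition "inner x y = qRe x * qRe y + qI x * qI y + qJ x * qJ y + qK x * qK y"

definition "norm q = sqrt ((qRe q)\<^sup>2 + (qI q)\<^sup>2 + (qJ q)\<^sup>2 + (qK q)\<^sup>2)"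

definition "sgn (x::quat) = x /\<^sub>R norm x"

definition "dist (x::quat) y = norm (x - y)"

definition
  "(uniformity :: (quat \<times> quat) filter) = (INF e\<in>{0 <..}. principal {(x, y). dist x y < e})"

definition
  "open (U :: quat set) \<longleftrightarrow> (\<forall>x\<in>U. eventually (\<lambda>(x', y). x' = x \<longrightarrow> y \<in> U) uniformity)"

instance
proof
  fix x y z :: quat and r :: real and U :: "quat set"
  show "inner x y = inner y x"
    by (simp add: inner_quat_def mult.commute)
  show "inner (x + y) z = inner x z + inner y z"
    by (simp add: inner_quat_def plus_quat_def distrib_right)
  show "inner (r *\<^sub>R x) y = r * inner x y"
    by (simp add: inner_quat_def scaleR_quat_def distrib_left)
  show "0 \<le> inner x x"
    by (simp add: inner_quat_def)
  show "inner x x = 0 \<longleftrightarrow> x = 0"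
    by (simp add: inner_quat_def zero_quat_def quat_eq_iff add_nonneg_eq_0_iff)
  show "norm x = sqrt (inner x x)"
    by (simp add: inner_quat_def norm_quat_def power2_eq_square)
  show "sgn x = x /\<^sub>R norm x"
    by (rule sgn_quat_def)
  show "dist x y = norm (x - y)"
    by (rule dist_quat_def)
  show "(uniformity :: (quat \<times> quat) filter) =
      (INF e\<in>{0 <..}. principal {(x, y). dist x y < e})"
    by (rule uniformity_quat_def)
  show "open U \<longleftrightarrow> (\<forall>x\<in>U. eventually (\<lambda>(x', y). x' = x \<longrightarrow> y \<in> U) uniformity)"
    by (rule open_quat_def)
qed

end

lemma mult_quat_cnj: "q * quat_cnj q = of_real ((norm q)\<^sup>2)"
  by (simp add: quat_eq_iff quat_cnj_def times_quat_def of_real_def one_quat_def scaleR_quat_def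
      norm_quat_def power2_eq_square)

lemma mult_quat_cnj_left: "quat_cnj q * q = of_real ((norm q)\<^sup>2)"
  by (simp add: quat_eq_iff quat_cnj_def times_quat_def of_real_def one_quat_def scaleR_quat_def
      norm_quat_def power2_eq_square)

instantiation quat :: real_normed_div_algebra
begin

definition "inverse q = quat_cnj q /\<^sub>R (norm q)\<^sup>2"

definition "x div y = x * inverse (y::quat)"

instance
proof
  fix x y :: quat
  show "x \<noteq> 0 \<Longrightarrow> inverse x * x = 1"
    by (simp add: inverse_quat_def mult_quat_cnj_left of_real_def)
  show "x \<noteq> 0 \<Longrightarrow> x * inverse x = 1"
    by (simp add: inverse_quat_def mult_quat_cnj of_real_def)
  show "x div y = x * inverse y"
    by (simp add: divide_quat_def)
  show "inverse (0::quat) = 0"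
    by (simp add: inverse_quat_def)
  show "norm (x * y) = norm x * norm y"
    unfolding norm_quat_def real_sqrt_mult [symmetric]
    by (rule arg_cong [where f = sqrt]) (simp add: times_quat_def power2_eq_square algebra_simps)
qed

end

instantiation quat :: euclidean_space
begin

definition "Basis = {1, quat_i, quat_j, quat_k}"

instance
proof
  fix u v x :: quat
  show "(Basis :: quat set) \<noteq> {}" "finite (Basis :: quat set)"
    by (simp_all add: Basis_quat_def)
  show "inner u v = (if u = v then 1 else 0)" if "u \<in> Basis" "v \<in> Basis"
    using that unfolding Basis_quat_def
    by (elim insertE emptyE)
      (simp_all add: inner_quat_def one_quat_def quat_i_def quat_j_def quat_k_def)
  show "(\<forall>u\<in>Basis. inner x u = 0) \<longleftrightarrow> x = 0"
    unfolding Basis_quat_def ball_simps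
    by (simp add: inner_quat_def one_quat_def quat_i_def quat_j_def quat_k_def
        quat_eq_iff zero_quat_def)
qed

end

section \<open>Square-integrable quaternion-valued functions and the Gabor transform\<close>

definition ennreal_sqrt :: "ennreal \<Rightarrow> ennreal" where
  "ennreal_sqrt x = (if x = \<infinity> then \<infinity> else ennreal (sqrt (enn2real x)))"

text \<open>Functions are genuine (not classes modulo null sets) and measurable in the sense of
  Lebesgue; the norm is extended real valued, so that square integrability is its finiteness.\<close>

definition L2_norm :: "(real^2 \<Rightarrow> quat) \<Rightarrow> ennreal" where
  "L2_norm f = ennreal_sqrt (\<integral>\<^sup>+x. ennreal ((norm (f x))\<^sup>2) \<partial>lebesgue)"

definition L2 :: "(real^2 \<Rightarrow> quat) set" where
  "L2 = {f \<in> borel_measurable lebesgue. L2_norm f < \<infinity>}"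

text \<open>\<^term>\<open>exp\<close> is the exponential of the Banach algebra of quaternions; multiplication is not
  commutative, so the order of the factors matters.\<close>

definition gqft :: "(real^2 \<Rightarrow> quat) \<Rightarrow> (real^2 \<Rightarrow> quat) \<Rightarrow> (real^2) \<times> (real^2) \<Rightarrow> quat" where
  "gqft \<phi> f = (\<lambda>(\<omega>, b). \<integral>x.
     exp (- (2 * pi * (x $ 1) * (\<omega> $ 1)) *\<^sub>R quat_i) * f x * quat_cnj (\<phi> (x - b)) *
     exp (- (2 * pi * (x $ 2) * (\<omega> $ 2)) *\<^sub>R quat_j) \<partial>lebesgue)"

end

theory Submission
  imports Defs "HOL-Probability.Characteristic_Functions"
begin

text \<open>
  Put \<open>E = \<parallel>f\<parallel>\<^sup>2 \<parallel>\<phi>\<parallel>\<^sup>2\<close>. By Cauchy-Schwarz the Gabor transform satisfies \<open>|G|\<^sup>2 \<le> E\<close> everywhere, and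
  by the Plancherel inequality, applied for each fixed \<open>b\<close> and integrated over \<open>b\<close>, \<open>E \<le> \<integral>|G|\<^sup>2\<close>. Hence
  a ball of volume at most \<open>1/2\<close> about the origin carries at most half of \<open>E\<close>, while outside of a ball of
  radius \<open>r\<close> the weight is at least \<open>r\<^sup>2\<^sup>s\<close>.

  The Plancherel inequality comes from damping with a Gaussian in \<open>\<omega>\<close>. Since the damping factor is even in each
  coordinate, only the real parts of the two exponentials survive the integration over \<open>\<omega>\<close>, so that
  non-commutativity plays no role and one gets \<open>\<integral>\<integral> k(y - x) \<langle>h(x), h(y)\<rangle> dx dy\<close> with a Gaussian kernel \<open>k\<close>. This differs
  from \<open>\<parallel>h\<parallel>\<^sup>2\<close> by \<open>1/2 \<integral> k(u) \<parallel>h(\<cdot> + u) - h\<parallel>\<^sup>2 du\<close>, which tends to zero by continuity of translations.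
\<close>

section \<open>Continuity of translations\<close>

lemma nn_integral_lborel_translation:
  fixes a :: "'a::euclidean_space"
  assumes [measurable]: "f \<in> borel_measurable borel"
  shows "(\<integral>\<^sup>+x. f (x + a) \<partial>lborel) = (\<integral>\<^sup>+x. f x \<partial>lborel)"
proof -
  have "(\<integral>\<^sup>+x. f x \<partial>lborel) = (\<integral>\<^sup>+x. f x \<partial>distr lborel borel ((+) a))"
    by (simp only: lborel_distr_plus)
  then show ?thesis
    by (simp add: nn_integral_distr add.commute)
qed

lemma nn_integral_lborel_scaleR:
  fixes f :: "'a::euclidean_space \<Rightarrow> ennreal"
  assumes [measurable]: "f \<in> borel_measurable borel" and "c \<noteq> 0"
  shows "(\<integral>\<^sup>+x. f x \<partial>lborel) = ennreal (\<bar>c\<bar> ^ DIM('a)) * (\<integral>\<^sup>+x. f (c *\<^sub>R x) \<partial>lborel)"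
  by (subst lborel_affine[OF assms(2), of 0])
     (simp add: nn_integral_density nn_integral_distr nn_integral_cmult)

lemma nn_integral_lborel_reflect:
  fixes f :: "'a::euclidean_space \<Rightarrow> ennreal"
  assumes [measurable]: "f \<in> borel_measurable borel"
  shows "(\<integral>\<^sup>+x. f (a - x) \<partial>lborel) = (\<integral>\<^sup>+x. f x \<partial>lborel)"
  using nn_integral_lborel_scaleR[of "\<lambda>x. f (x + a)" "-1"] nn_integral_lborel_translation[of f a]
  by (simp add: add.commute)

section \<open>Continuity of translations in \<open>L^1\<close>\<close>

lemma ennreal_dense_real:
  assumes "0 < (e::ennreal)"
  obtains d :: real where "0 < d" "ennreal d < e"
proof -
  obtain c where c: "0 < c" "c < e" using dense[OF assms] by auto
  moreover from c have "c < top" by (meson less_le_trans top_greatest)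
  ultimately show thesis
    using that[of "enn2real c"] by (simp add: enn2real_positive_iff)
qed

lemma tendsto_ennreal_0_le:
  fixes f :: "'a \<Rightarrow> ennreal"
  assumes "(g \<longlongrightarrow> 0) F" "\<And>x. f x \<le> g x"
  shows "(f \<longlongrightarrow> 0) F"
  by (rule tendsto_sandwich[OF _ _ tendsto_const assms(1)]) (use assms in auto)

text \<open>For \<open>x\<close> in the open set \<open>U\<close> the point \<open>x + u n\<close>
  eventually lies in \<open>U\<close> as well, so the indicators tend to 0 pointwise; the finite
  measure of \<open>U\<close> makes its indicator an integrable bound.\<close>

lemma translation_open_tendsto_0:
  fixes U :: "'a::euclidean_space set" and u :: "nat \<Rightarrow> 'a"
  assumes "open U" "emeasure lborel U < \<infinity>" "u \<longlonglongrightarrow> 0"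
  shows "(\<lambda>n. emeasure lborel (U - {x. x + u n \<in> U})) \<longlonglongrightarrow> 0"
proof -
  have [measurable]: "U \<in> sets borel" using assms by auto
  have "(\<lambda>n. \<integral>\<^sup>+x. indicator (U - {x. x + u n \<in> U}) x \<partial>lborel) \<longlonglongrightarrow> (\<integral>\<^sup>+x. 0 \<partial>(lborel :: 'a measure))"
  proof (rule nn_integral_dominated_convergence[where w = "indicator U"])
    show "AE x in lborel. (\<lambda>n. indicator (U - {x. x + u n \<in> U}) x :: ennreal) \<longlonglongrightarrow> 0"
    proof (rule AE_I2, rule tendsto_eventually)
      fix x
      have "(\<lambda>n. x + u n) \<longlonglongrightarrow> x" using tendsto_add[OF tendsto_const assms(3)] by simp
      then have "x \<in> U \<Longrightarrow> eventually (\<lambda>n. x + u n \<in> U) sequentially"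
        using assms(1) by (simp add: topological_tendstoD)
      then show "eventually (\<lambda>n. indicator (U - {x. x + u n \<in> U}) x = (0::ennreal)) sequentially"
        by (cases "x \<in> U") (auto elim: eventually_mono)
    qed
  qed (use assms in \<open>auto split: split_indicator\<close>)
  then show ?thesis by simp
qed

text \<open>The set \<open>B\<close> is replaced by a superset \<open>U\<close>, at the price of
  \<open>U - B\<close> once at \<open>x\<close> and once at \<open>x + u\<close>. The two one-sided
  mismatches between \<open>U\<close> and its translate have equal measure, hence the first factor
  2.\<close>

lemma nn_integral_indicator_translation_le:
  fixes U B :: "'a::euclidean_space set"
  assumes [measurable]: "U \<in> sets borel" "B \<in> sets borel"
    and "B \<subseteq> U" "emeasure lborel U < \<infinity>"
  shows "(\<integral>\<^sup>+x. ennreal \<bar>indicator B (x + u) - indicator B x :: real\<bar> \<partial>lborel)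
    \<le> 2 * emeasure lborel (U - {x. x + u \<in> U}) + 2 * emeasure lborel (U - B)"
proof -
  let ?V = "{x. x + u \<in> U}"
  have [measurable]: "?V \<in> sets borel" by measurable
  have V: "emeasure lborel ?V = emeasure lborel U"
    using nn_integral_lborel_translation[of "indicator U" u]
    by (simp add: nn_integral_indicator[symmetric] indicator_def del: nn_integral_indicator)
  have I: "emeasure lborel (U \<inter> ?V) < \<infinity>"
    using assms(4) emeasure_mono[of "U \<inter> ?V" U lborel] by (auto intro: le_less_trans)
  have "emeasure lborel ?V = emeasure lborel (?V - U) + emeasure lborel (U \<inter> ?V)"
    by (subst plus_emeasure) (auto intro!: arg_cong[where f = "emeasure lborel"])
  moreover have "emeasure lborel U = emeasure lborel (U - ?V) + emeasure lborel (U \<inter> ?V)"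
    by (subst plus_emeasure) (auto intro!: arg_cong[where f = "emeasure lborel"])
  \<comment> \<open>\<open>U\<close> and \<open>?V\<close> have the same measure, and their
    intersection has finite measure, so it cancels.\<close>
  ultimately have eq: "emeasure lborel (?V - U) = emeasure lborel (U - ?V)"
    using V I by (auto simp: add.commute[of _ "emeasure lborel (U \<inter> ?V)"] ennreal_add_left_cancel)
  have "ennreal \<bar>indicator B (x + u) - indicator B x :: real\<bar>
    \<le> indicator (?V - U) x + indicator (U - ?V) x + indicator (U - B) x + indicator (U - B) (x + u)" for x
    using assms(3) by (auto simp: indicator_def)
  then have "(\<integral>\<^sup>+x. ennreal \<bar>indicator B (x + u) - indicator B x :: real\<bar> \<partial>lborel) \<le>
    (\<integral>\<^sup>+x. indicator (?V - U) x + indicator (U - ?V) x + indicator (U - B) x + indicator (U - B) (x + u) \<partial>lborel)"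
    by (intro nn_integral_mono)
  also have "\<dots> = emeasure lborel (?V - U) + emeasure lborel (U - ?V) + emeasure lborel (U - B) + emeasure lborel (U - B)"
    by (simp add: nn_integral_add nn_integral_lborel_translation[of "indicator (U - B)" u])
  finally show ?thesis by (simp add: eq mult_2 add_ac)
qed

text \<open>Induction over the integrable functions: indicators by outer regularity, sums by the
  triangle inequality, limits by an approximation error that is uniform in the shift.\<close>

lemma translation_L1_tendsto_0:
  fixes g :: "'a::euclidean_space \<Rightarrow> 'b::{banach, second_countable_topology}" and u :: "nat \<Rightarrow> 'a"
  assumes "integrable lborel g" "u \<longlonglongrightarrow> 0"
  shows "(\<lambda>n. \<integral>\<^sup>+x. norm (g (x + u n) - g x) \<partial>lborel) \<longlonglongrightarrow> 0"
  using assms(1)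
proof (induction rule: integrable_induct)
  case (base B c)
  then have [measurable]: "B \<in> sets borel" by simp
  have "(\<lambda>n. \<integral>\<^sup>+x. ennreal \<bar>indicator B (x + u n) - indicator B x :: real\<bar> \<partial>lborel) \<longlonglongrightarrow> 0"
  proof (rule order_tendstoI)
    fix e :: ennreal assume "0 < e"
    then obtain d :: real where d: "0 < d" "ennreal d < e"
      by (rule ennreal_dense_real)
    \<comment> \<open>Outer regularity passes from \<open>B\<close> to an open set. The margin
      \<open>d / 4\<close> fits the two doubled terms of the bound, which then add up to at most
      \<open>d\<close>.\<close>
    obtain U where U: "open U" "B \<subseteq> U" "emeasure lborel (U - B) < ennreal (d / 4)"
      using outer_regular_lborel[of B "d / 4"] d by auto
    then have [measurable]: "U \<in> sets borel" by auto
    have "emeasure lborel U = emeasure lborel B + emeasure lborel (U - B)"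
      using U by (subst plus_emeasure) (auto intro!: arg_cong[where f = "emeasure lborel"])
    with base U have fin: "emeasure lborel U < \<infinity>"
      by (auto simp: less_top[symmetric] intro: less_trans)
    have "eventually (\<lambda>n. emeasure lborel (U - {x. x + u n \<in> U}) < ennreal (d / 4)) sequentially"
      using translation_open_tendsto_0[OF U(1) fin assms(2)] d by (intro order_tendstoD) auto
    then show "eventually (\<lambda>n. (\<integral>\<^sup>+x. ennreal \<bar>indicator B (x + u n) - indicator B x :: real\<bar> \<partial>lborel) < e) sequentially"
    proof eventually_elim
      case (elim n)
      have "(\<integral>\<^sup>+x. ennreal \<bar>indicator B (x + u n) - indicator B x :: real\<bar> \<partial>lborel)
        \<le> 2 * emeasure lborel (U - {x. x + u n \<in> U}) + 2 * emeasure lborel (U - B)"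
        using U fin by (intro nn_integral_indicator_translation_le) auto
      also have "\<dots> \<le> 2 * ennreal (d / 4) + 2 * ennreal (d / 4)"
        using elim U by (intro add_mono mult_left_mono) auto
      also have "\<dots> = ennreal d"
        using d by (simp add: ennreal_numeral[symmetric] ennreal_mult[symmetric] ennreal_plus[symmetric]
            del: ennreal_numeral ennreal_plus)
      finally show ?case using d by simp
    qed
  qed simp
  then have "(\<lambda>n. ennreal (norm c) * (\<integral>\<^sup>+x. ennreal \<bar>indicator B (x + u n) - indicator B x :: real\<bar> \<partial>lborel)) \<longlonglongrightarrow> ennreal (norm c) * 0"
    by (intro ennreal_tendsto_cmult) auto
  moreover have "norm (indicat_real B (x + u n) *\<^sub>R c - indicat_real B x *\<^sub>R c)
    = norm c * \<bar>indicator B (x + u n) - indicator B x\<bar>" for x n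
    by (simp add: scaleR_diff_left[symmetric])
  ultimately show ?case
    by (simp add: ennreal_mult nn_integral_cmult)
next
  case (add f g)
  have [measurable]: "f \<in> borel_measurable borel" "g \<in> borel_measurable borel"
    using add by auto
  have "(\<lambda>n. (\<integral>\<^sup>+x. norm (f (x + u n) - f x) \<partial>lborel) + (\<integral>\<^sup>+x. norm (g (x + u n) - g x) \<partial>lborel)) \<longlonglongrightarrow> 0 + 0"
    using add by (intro tendsto_add) auto
  then have "(\<lambda>n. (\<integral>\<^sup>+x. norm (f (x + u n) - f x) \<partial>lborel) + (\<integral>\<^sup>+x. norm (g (x + u n) - g x) \<partial>lborel)) \<longlonglongrightarrow> 0"
    by simp
  then show ?case
  proof (rule tendsto_ennreal_0_le)
    fix n
    have "norm (f (x + u n) + g (x + u n) - (f x + g x)) \<le> norm (f (x + u n) - f x) + norm (g (x + u n) - g x)" for x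
      by norm
    then have "(\<integral>\<^sup>+x. norm (f (x + u n) + g (x + u n) - (f x + g x)) \<partial>lborel) \<le>
      (\<integral>\<^sup>+x. ennreal (norm (f (x + u n) - f x)) + ennreal (norm (g (x + u n) - g x)) \<partial>lborel)"
      by (intro nn_integral_mono) (simp add: ennreal_plus[symmetric] del: ennreal_plus)
    also have "\<dots> = (\<integral>\<^sup>+x. norm (f (x + u n) - f x) \<partial>lborel) + (\<integral>\<^sup>+x. norm (g (x + u n) - g x) \<partial>lborel)"
      by (subst nn_integral_add) auto
    finally show "(\<integral>\<^sup>+x. norm (f (x + u n) + g (x + u n) - (f x + g x)) \<partial>lborel) \<le> \<dots>" .
  qed
next
  case (lim f s)
  have [measurable]: "f \<in> borel_measurable borel" "\<And>i. s i \<in> borel_measurable borel"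
    using lim by (auto dest: borel_measurable_integrable)
  have app: "(\<lambda>i. \<integral>\<^sup>+x. norm (s i x - f x) \<partial>lborel) \<longlonglongrightarrow> 0"
  proof -
    have "(\<lambda>i. \<integral>\<^sup>+x. norm (s i x - f x) \<partial>lborel) \<longlonglongrightarrow> (\<integral>\<^sup>+x. 0 \<partial>(lborel :: 'a measure))"
    proof (rule nn_integral_dominated_convergence[where w = "\<lambda>x. ennreal (3 * norm (f x))"])
      \<comment> \<open>The induction rule supplies
        \<open>norm (s i x) \<le> 2 * norm (f x)\<close>, hence the factor 3.\<close>
      show "AE x in lborel. ennreal (norm (s i x - f x)) \<le> ennreal (3 * norm (f x))" for i
      proof (intro AE_I2 ennreal_leI)
        fix x show "norm (s i x - f x) \<le> 3 * norm (f x)"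
          using lim(3)[of x i] norm_triangle_ineq4[of "s i x" "f x"] by simp
      qed
      show "(\<integral>\<^sup>+x. ennreal (3 * norm (f x)) \<partial>lborel) < \<infinity>"
        using lim(4) by (simp add: ennreal_mult nn_integral_cmult integrable_iff_bounded ennreal_mult_less_top)
      show "AE x in lborel. (\<lambda>i. ennreal (norm (s i x - f x))) \<longlonglongrightarrow> 0"
      proof (rule AE_I2)
        fix x
        have "(\<lambda>i. ennreal (norm (s i x - f x))) \<longlonglongrightarrow> ennreal (norm (f x - f x))"
          using lim(2)[of x] by (intro tendsto_intros) auto
        then show "(\<lambda>i. ennreal (norm (s i x - f x))) \<longlonglongrightarrow> 0" by simp
      qed
    qed auto
    then show ?thesis by simp
  qed
  \<comment> \<open>The errors at \<open>x + u n\<close> and at \<open>x\<close> have the same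
    integral by translation invariance, so the approximation costs a term independent of
    \<open>n\<close>.\<close>
  have bd: "(\<integral>\<^sup>+x. norm (f (x + u n) - f x) \<partial>lborel) \<le>
      2 * (\<integral>\<^sup>+x. norm (s i x - f x) \<partial>lborel) + (\<integral>\<^sup>+x. norm (s i (x + u n) - s i x) \<partial>lborel)" for i n
  proof -
    have "norm (f (x + u n) - f x) \<le> norm (s i (x + u n) - f (x + u n)) + norm (s i x - f x)
        + norm (s i (x + u n) - s i x)" for x
      by norm
    then have "(\<integral>\<^sup>+x. norm (f (x + u n) - f x) \<partial>lborel) \<le>
      (\<integral>\<^sup>+x. ennreal (norm (s i (x + u n) - f (x + u n))) + ennreal (norm (s i x - f x))
        + ennreal (norm (s i (x + u n) - s i x)) \<partial>lborel)"
      by (intro nn_integral_mono) (simp add: ennreal_plus[symmetric] del: ennreal_plus)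
    also have "\<dots> = (\<integral>\<^sup>+x. norm (s i (x + u n) - f (x + u n)) \<partial>lborel) + (\<integral>\<^sup>+x. norm (s i x - f x) \<partial>lborel)
      + (\<integral>\<^sup>+x. norm (s i (x + u n) - s i x) \<partial>lborel)"
      by (simp add: nn_integral_add)
    finally show ?thesis
      using nn_integral_lborel_translation[of "\<lambda>x. ennreal (norm (s i x - f x))" "u n"]
      by (simp add: mult_2)
  qed
  show ?case
  proof (rule order_tendstoI)
    fix e :: ennreal assume "0 < e"
    then obtain d :: real where d: "0 < d" "ennreal d < e"
      by (rule ennreal_dense_real)
    have "eventually (\<lambda>i. (\<integral>\<^sup>+x. norm (s i x - f x) \<partial>lborel) < ennreal (d / 4)) sequentially"
      using app d by (intro order_tendstoD) auto
    \<comment> \<open>The approximant is fixed first; only its own translations then remain to be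
      controlled in \<open>n\<close>.\<close>
    then obtain i where i: "(\<integral>\<^sup>+x. norm (s i x - f x) \<partial>lborel) < ennreal (d / 4)"
      by (auto simp: eventually_sequentially)
    have "eventually (\<lambda>n. (\<integral>\<^sup>+x. norm (s i (x + u n) - s i x) \<partial>lborel) < ennreal (d / 2)) sequentially"
      using lim(5)[of i] d by (intro order_tendstoD) auto
    then show "eventually (\<lambda>n. (\<integral>\<^sup>+x. norm (f (x + u n) - f x) \<partial>lborel) < e) sequentially"
    proof eventually_elim
      case (elim n)
      have "(\<integral>\<^sup>+x. norm (f (x + u n) - f x) \<partial>lborel) \<le> 2 * ennreal (d / 4) + ennreal (d / 2)"
        using i elim by (intro order.trans[OF bd[of n i]] add_mono mult_left_mono) auto
      also have "\<dots> = ennreal d"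
        using d by (simp add: ennreal_numeral[symmetric] ennreal_mult[symmetric] ennreal_plus[symmetric]
            del: ennreal_numeral ennreal_plus)
      finally show ?case using d by simp
    qed
  qed simp
qed

text \<open>Deduces continuity of translations in $L^2$ from that in $L^1$, applied to \<open>|h| h\<close>.\<close>

lemma norm_diff_power2_le:
  fixes a b :: "'a::real_inner"
  shows "(norm (a - b))\<^sup>2 \<le> 2 * norm (norm a *\<^sub>R a - norm b *\<^sub>R b)"
proof (cases "a = b")
  case False
  let ?D = "norm a *\<^sub>R a - norm b *\<^sub>R b"
  have n: "inner a a = norm a * norm a" "inner b b = norm b * norm b"
    by (simp_all add: power2_norm_eq_inner[symmetric] power2_eq_square)
  have d: "(norm (a - b))\<^sup>2 = norm a * norm a + norm b * norm b - 2 * inner a b"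
    by (simp add: power2_norm_eq_inner inner_diff inner_commute n)
  \<comment> \<open>Pairing \<open>?D\<close> with \<open>a - b\<close> bounds the cube of
    \<open>norm (a - b)\<close>; Cauchy-Schwarz and division by \<open>norm (a - b)\<close> then
    give the claim.\<close>
  have "2 * inner ?D (a - b) = (norm a + norm b) * (norm (a - b))\<^sup>2 + (norm a - norm b)\<^sup>2 * (norm a + norm b)"
    unfolding d by (simp add: inner_diff inner_commute n power2_eq_square algebra_simps)
  moreover have "norm (a - b) * (norm (a - b))\<^sup>2 \<le> (norm a + norm b) * (norm (a - b))\<^sup>2"
    by (intro mult_right_mono norm_triangle_ineq4) auto
  moreover have "0 \<le> (norm a - norm b)\<^sup>2 * (norm a + norm b)" by simp
  moreover have "inner ?D (a - b) \<le> norm ?D * norm (a - b)" by (rule norm_cauchy_schwarz)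
  ultimately have "norm (a - b) * (norm (a - b))\<^sup>2 \<le> 2 * (norm ?D * norm (a - b))"
    by linarith
  then have "norm (a - b) * (norm (a - b))\<^sup>2 \<le> norm (a - b) * (2 * norm ?D)"
    by (simp only: mult_ac)
  then show ?thesis using False by simp
qed simp

lemma translation_L2_tendsto_0:
  fixes h :: "'a::euclidean_space \<Rightarrow> 'b::euclidean_space" and u :: "nat \<Rightarrow> 'a"
  assumes [measurable]: "h \<in> borel_measurable borel"
    and fin: "(\<integral>\<^sup>+x. (norm (h x))\<^sup>2 \<partial>lborel) < \<infinity>" and u: "u \<longlonglongrightarrow> 0"
  shows "(\<lambda>n. \<integral>\<^sup>+x. (norm (h (x + u n) - h x))\<^sup>2 \<partial>lborel) \<longlonglongrightarrow> 0"
proof -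
  let ?P = "\<lambda>x. norm (h x) *\<^sub>R h x"
  \<comment> \<open>The norm of \<open>?P x\<close> is \<open>(norm (h x))\<^sup>2\<close>, so
    square integrability of \<open>h\<close> is integrability of \<open>?P\<close>.\<close>
  have "integrable lborel ?P"
    using fin by (simp add: integrable_iff_bounded power2_eq_square)
  from ennreal_tendsto_cmult[OF _ translation_L1_tendsto_0[OF this u], of 2]
  have "(\<lambda>n. 2 * \<integral>\<^sup>+x. norm (?P (x + u n) - ?P x) \<partial>lborel) \<longlonglongrightarrow> 0" by simp
  then show ?thesis
  proof (rule tendsto_ennreal_0_le)
    fix n
    have "(\<integral>\<^sup>+x. (norm (h (x + u n) - h x))\<^sup>2 \<partial>lborel) \<le> (\<integral>\<^sup>+x. 2 * ennreal (norm (?P (x + u n) - ?P x)) \<partial>lborel)"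
      by (intro nn_integral_mono)
         (metis norm_diff_power2_le ennreal_leI ennreal_mult' ennreal_numeral zero_le_numeral)
    then show "(\<integral>\<^sup>+x. (norm (h (x + u n) - h x))\<^sup>2 \<partial>lborel) \<le> 2 * \<integral>\<^sup>+x. norm (?P (x + u n) - ?P x) \<partial>lborel"
      by (subst (asm) nn_integral_cmult) auto
  qed
qed

section \<open>Quaternionic exponentials and product integrals\<close>

text \<open>Euler's formula is transported from the complex numbers along \<open>\<psi>\<close>, the
  real algebra homomorphism that sends the complex unit to \<open>u\<close>; being bounded and
  linear, it commutes with the exponential series.\<close>

lemma exp_scaleR_imag_unit:
  fixes u :: quat
  assumes u: "u * u = - 1"
  shows "exp (t *\<^sub>R u) = cos t *\<^sub>R 1 + sin t *\<^sub>R u"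
proof -
  define \<psi> :: "complex \<Rightarrow> quat" where "\<psi> z = Re z *\<^sub>R 1 + Im z *\<^sub>R u" for z
  have mult: "\<psi> (z * w) = \<psi> z * \<psi> w" for z w
    by (simp add: \<psi>_def algebra_simps u)
  have pow: "\<psi> (z ^ n) = \<psi> z ^ n" for z n
    by (induction n) (simp_all add: mult, simp add: \<psi>_def)
  have bl: "bounded_linear \<psi>"
    unfolding \<psi>_def
    by (intro bounded_linear_add bounded_linear_scaleR_left[THEN bounded_linear_compose] bounded_linear_Re bounded_linear_Im)
  have "\<psi> (exp z) = exp (\<psi> z)" for z
    unfolding exp_def
    by (subst bounded_linear.suminf[OF bl summable_exp_generic])
       (simp add: linear_scale[OF bounded_linear.linear[OF bl]] pow)
  from this[of "\<i> * of_real t"] show ?thesis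
    by (simp add: \<psi>_def cis_conv_exp[symmetric])
qed

lemmas exp_quat_i = exp_scaleR_imag_unit[OF quat_units(1)]
lemmas exp_quat_j = exp_scaleR_imag_unit[OF quat_units(2)]

lemma norm_exp_quat_i [simp]: "norm (exp (t *\<^sub>R quat_i)) = 1"
  and norm_exp_quat_j [simp]: "norm (exp (t *\<^sub>R quat_j)) = 1"
  unfolding exp_quat_i exp_quat_j
  by (simp_all add: norm_quat_def quat_i_def quat_j_def plus_quat_def
      scaleR_quat_def one_quat_def)

text \<open>The phases enter only through their difference, and the term that involves the imaginary
  unit carries the odd function \<open>sin\<close>, which integrates to 0 against an even
  weight.\<close>

lemma inner_exp_quat_i:
  "inner (exp (a *\<^sub>R quat_i) * p) (exp (b *\<^sub>R quat_i) * q) =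
    cos (a - b) * inner p q + sin (a - b) * inner (quat_i * p) q"
  unfolding exp_quat_i
  by (simp add: inner_quat_def quat_i_def plus_quat_def times_quat_def
      scaleR_quat_def one_quat_def cos_diff sin_diff) (simp add: algebra_simps)

lemma inner_exp_quat_j:
  "inner (p * exp (a *\<^sub>R quat_j)) (q * exp (b *\<^sub>R quat_j)) =
    cos (a - b) * inner p q + sin (a - b) * inner (p * quat_j) q"
  unfolding exp_quat_j
  by (simp add: inner_quat_def quat_j_def plus_quat_def times_quat_def
      scaleR_quat_def one_quat_def cos_diff sin_diff) (simp add: algebra_simps)

lemma norm_quat_cnj [simp]: "norm (quat_cnj q) = norm q"
  by (simp add: norm_quat_def quat_cnj_def)

lemma continuous_quat_cnj: "continuous_on UNIV quat_cnj"
proof -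
  have "linear quat_cnj"
    by (rule linearI) (simp_all add: quat_cnj_def plus_quat_def scaleR_quat_def)
  then show ?thesis
    by (simp add: linear_continuous_on linear_linear)
qed

lemma borel_measurable_quat_cnj [measurable (raw)]:
  "f \<in> borel_measurable M \<Longrightarrow> (\<lambda>x. quat_cnj (f x)) \<in> borel_measurable M"
  using borel_measurable_continuous_on[OF continuous_quat_cnj] .

lemma borel_measurable_exp_quat [measurable (raw)]:
  assumes [measurable]: "f \<in> borel_measurable M"
  shows "(\<lambda>x. exp (f x *\<^sub>R quat_i)) \<in> borel_measurable M"
    and "(\<lambda>x. exp (f x *\<^sub>R quat_j)) \<in> borel_measurable M"
  unfolding exp_quat_i exp_quat_j by measurable

lemma borel_measurable_vec_nth' [measurable (raw)]:
  fixes f :: "'a \<Rightarrow> real^'n"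
  assumes "f \<in> borel_measurable M"
  shows "(\<lambda>x. f x $ i) \<in> borel_measurable M"
  by (rule borel_measurable_continuous_on[OF _ assms]) (intro continuous_intros)

text \<open>Stated for any bounded bilinear product because it serves both real multiplication and
  the quaternion inner product. The norm bound makes the product integrable; Fubini then pulls out
  one factor at a time.\<close>

lemma has_bochner_integral_bilinear_pair:
  fixes f :: "'a::euclidean_space \<Rightarrow> 'c::{banach, second_countable_topology}"
    and g :: "'b::euclidean_space \<Rightarrow> 'd::{banach, second_countable_topology}"
    and prod :: "'c \<Rightarrow> 'd \<Rightarrow> 'e::{banach, second_countable_topology}"
  assumes "bounded_bilinear prod" and f: "integrable lborel f" and g: "integrable lborel g"
  shows "has_bochner_integral lborel (\<lambda>p. prod (f (fst p)) (g (snd p)))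
    (prod (\<integral>x. f x \<partial>lborel) (\<integral>y. g y \<partial>lborel))"
proof -
  interpret bounded_bilinear prod by fact
  have [measurable]: "f \<in> borel_measurable borel" "g \<in> borel_measurable borel"
    using f g by (auto dest: borel_measurable_integrable)
  obtain K where K: "0 < K" "\<And>a b. norm (prod a b) \<le> norm a * norm b * K"
    using pos_bounded by auto
  let ?F = "\<lambda>p. prod (f (fst p)) (g (snd p))"
  have m: "?F \<in> borel_measurable (lborel \<Otimes>\<^sub>M lborel)"
    by (rule borel_measurable_continuous_Pair[where H = prod])
       (auto intro!: continuous_on simp: continuous_intros)
  have "(\<integral>\<^sup>+p. norm (?F p) \<partial>(lborel \<Otimes>\<^sub>M lborel)) \<le>
    (\<integral>\<^sup>+p. ennreal K * (ennreal (norm (f (fst p))) * ennreal (norm (g (snd p)))) \<partial>(lborel \<Otimes>\<^sub>M lborel))"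
    using K by (intro nn_integral_mono) (simp add: ennreal_mult[symmetric] mult_ac)
  also have "\<dots> = ennreal K * ((\<integral>\<^sup>+x. norm (f x) \<partial>lborel) * (\<integral>\<^sup>+y. norm (g y) \<partial>lborel))"
    by (subst lborel.nn_integral_fst[symmetric]) (simp_all add: nn_integral_cmult nn_integral_multc)
  also have "\<dots> < \<infinity>"
    using f g by (simp add: integrable_iff_bounded ennreal_mult_less_top)
  finally have i: "integrable (lborel \<Otimes>\<^sub>M lborel) ?F"
    using m by (simp add: integrable_iff_bounded)
  have "(\<integral>p. ?F p \<partial>(lborel \<Otimes>\<^sub>M lborel)) = (\<integral>x. \<integral>y. prod (f x) (g y) \<partial>lborel \<partial>lborel)"
    using lborel_pair.integral_fst'[OF i] by simp
  also have "\<dots> = (\<integral>x. prod (f x) (\<integral>y. g y \<partial>lborel) \<partial>lborel)"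
    by (simp add: integral_bounded_linear[OF bounded_linear_right g])
  also have "\<dots> = prod (\<integral>x. f x \<partial>lborel) (\<integral>y. g y \<partial>lborel)"
    by (simp add: integral_bounded_linear[OF bounded_linear_left f])
  finally show ?thesis
    using i by (simp add: has_bochner_integral_iff lborel_prod)
qed

section \<open>Lebesgue measure on the plane as a product measure\<close>

lemma borel_measurable_vector2 [measurable]:
  "(\<lambda>p. vector [fst p, snd p] :: real^2) \<in> borel_measurable (borel :: (real \<times> real) measure)"
proof (rule borel_measurable_continuous_onI)
  have eq: "(\<lambda>p. vector [fst p, snd p] :: real^2) = (\<lambda>p. \<chi> i. if i = 1 then fst p else snd p)"
    by (auto simp: vec_eq_iff forall_2)
  have "continuous_on UNIV (\<lambda>p::real\<times>real. if i = 1 then fst p else snd p)" for i :: 2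
    by (cases "i = 1") (auto intro!: continuous_intros)
  then show "continuous_on UNIV (\<lambda>p::real\<times>real. vector [fst p, snd p] :: real^2)"
    unfolding eq by (rule continuous_on_vec_lambda)
qed

text \<open>\<open>real^2\<close> and \<open>real \<times> real\<close> are different types. A box
  pulls back to a product of intervals, and the values on boxes determine Lebesgue measure.\<close>

lemma lborel_real2:
  "lborel = distr (lborel :: (real \<times> real) measure) borel (\<lambda>p. vector [fst p, snd p] :: real^2)"
proof (rule lborel_eqI)
  fix l u :: "real^2"
  assume le: "\<And>b. b \<in> Basis \<Longrightarrow> l \<bullet> b \<le> u \<bullet> b"
  have "(\<lambda>p. vector [fst p, snd p] :: real^2) -` box l u = box (l $ 1) (u $ 1) \<times> box (l $ 2) (u $ 2)"
    by (auto simp: mem_box_cart forall_2 box_real)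
  moreover have "l $ 1 \<le> u $ 1" "l $ 2 \<le> u $ 2"
    using le[of "axis 1 1"] le[of "axis 2 1"] by (auto simp: axis_in_Basis_iff inner_axis)
  moreover have "(\<Prod>b\<in>Basis. (u - l) \<bullet> b) = (u $ 1 - l $ 1) * (u $ 2 - l $ 2)"
  proof -
    have "Basis = {axis 1 1, axis 2 1 :: real^2}"
      by (auto simp: Basis_vec_def UNIV_2)
    show ?thesis
      unfolding \<open>Basis = _\<close> by (simp add: inner_axis axis_eq_axis)
  qed
  moreover have "emeasure (distr (lborel :: (real \<times> real) measure) borel (\<lambda>p. vector [fst p, snd p] :: real^2)) (box l u)
    = emeasure (lborel :: (real \<times> real) measure) ((\<lambda>p. vector [fst p, snd p] :: real^2) -` box l u)"
    by (simp add: emeasure_distr)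
  ultimately show "emeasure (distr (lborel :: (real \<times> real) measure) borel (\<lambda>p. vector [fst p, snd p] :: real^2)) (box l u)
    = (\<Prod>b\<in>Basis. (u - l) \<bullet> b)"
    by (simp add: lborel_prod[symmetric] lborel.emeasure_pair_measure_Times ennreal_mult)
qed simp

lemma has_bochner_integral_real2:
  fixes f g :: "real \<Rightarrow> real"
  assumes "integrable lborel f" "integrable lborel g"
  shows "has_bochner_integral lborel (\<lambda>x::real^2. f (x $ 1) * g (x $ 2))
    ((\<integral>x. f x \<partial>lborel) * (\<integral>y. g y \<partial>lborel))"
proof -
  have [measurable]: "f \<in> borel_measurable borel" "g \<in> borel_measurable borel"
    using assms by (auto dest: borel_measurable_integrable)
  show ?thesis
    using has_bochner_integral_bilinear_pair[OF bounded_bilinear_mult assms]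
    by (subst lborel_real2) (simp add: has_bochner_integral_distr)
qed

section \<open>The Gaussian-damped quaternion Fourier transform\<close>

text \<open>The width is chosen so that the Fourier transform is the normal density with standard
  deviation \<open>\<sigma>\<close>; the damping fades as \<open>\<sigma>\<close> tends to
  0.\<close>

definition gauss_weight :: "real \<Rightarrow> real \<Rightarrow> real" where
  "gauss_weight \<sigma> t = exp (- (2 * pi * \<sigma> * t)\<^sup>2 / 2)"

lemma borel_measurable_gauss_weight [measurable]: "gauss_weight \<sigma> \<in> borel_measurable borel"
  unfolding gauss_weight_def by measurable

text \<open>These are the real and imaginary parts of the characteristic function of the standard
  normal distribution.\<close>

lemma fourier_std_normal_density:
  "has_bochner_integral lborel (\<lambda>v. std_normal_density v * cos (t * v)) (exp (- t\<^sup>2 / 2))"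
  "has_bochner_integral lborel (\<lambda>v. std_normal_density v * sin (t * v)) 0"
proof -
  let ?f = "\<lambda>v. std_normal_density v *\<^sub>R iexp (t * v)"
  have int: "integrable lborel ?f"
    by (rule Bochner_Integration.integrable_bound[OF integrable_normal_density[of 1 0]]) auto
  have "(\<integral>v. ?f v \<partial>lborel) = char std_normal_distribution t"
    unfolding char_def by (subst integral_density) auto
  then have val: "(\<integral>v. ?f v \<partial>lborel) = exp (- t\<^sup>2 / 2)"
    by (simp add: char_std_normal_distribution)
  have ri: "Re (?f v) = std_normal_density v * cos (t * v)" "Im (?f v) = std_normal_density v * sin (t * v)" for v
    by (simp_all add: cis_conv_exp[symmetric] del: of_real_mult)
  show "has_bochner_integral lborel (\<lambda>v. std_normal_density v * cos (t * v)) (exp (- t\<^sup>2 / 2))"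
    using integral_Re[OF int] integrable_Re[OF int] by (simp only: ri val has_bochner_integral_iff Re_complex_of_real)
  show "has_bochner_integral lborel (\<lambda>v. std_normal_density v * sin (t * v)) 0"
    using integral_Im[OF int] integrable_Im[OF int] by (simp only: ri val has_bochner_integral_iff Im_complex_of_real)
qed

text \<open>The substitution \<open>v = 2 * pi * \<sigma> * t\<close> at frequency
  \<open>x / \<sigma>\<close> reduces this to the standard normal density; the constant
  \<open>sqrt (2 * pi) / (2 * pi * \<sigma>)\<close> is the normalisation of the target
  density.\<close>

lemma fourier_gauss_weight:
  assumes "\<sigma> > 0"
  shows "has_bochner_integral lborel (\<lambda>t. gauss_weight \<sigma> t * cos (2 * pi * x * t)) (normal_density 0 \<sigma> x)"
    and "has_bochner_integral lborel (\<lambda>t. gauss_weight \<sigma> t * sin (2 * pi * x * t)) 0"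
proof -
  have w: "gauss_weight \<sigma> t = sqrt (2 * pi) * std_normal_density (2 * pi * \<sigma> * t)" for t
    by (simp add: gauss_weight_def std_normal_density_def)
  then have w': "gauss_weight \<sigma> t * y = sqrt (2 * pi) * (std_normal_density (2 * pi * \<sigma> * t) * y)" for t y
    by simp
  have c: "2 * pi * \<sigma> \<noteq> 0" using assms by simp
  have arg: "x / \<sigma> * (2 * pi * \<sigma> * t) = 2 * pi * x * t" for t
    using assms by (simp add: field_simps)
  \<comment> \<open>The summand \<open>0 +\<close> gives the integrand the shape of the affine
    substitution rule.\<close>
  have "has_bochner_integral lborel (\<lambda>t. sqrt (2 * pi) * (std_normal_density (0 + 2 * pi * \<sigma> * t) * cos (x / \<sigma> * (0 + 2 * pi * \<sigma> * t))))
    (sqrt (2 * pi) * (exp (- (x / \<sigma>)\<^sup>2 / 2) /\<^sub>R \<bar>2 * pi * \<sigma>\<bar>))"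
    by (intro has_bochner_integral_mult_right lborel_has_bochner_integral_real_affine_iff[OF c,
          of "\<lambda>v. std_normal_density v * cos (x / \<sigma> * v)", THEN iffD1] fourier_std_normal_density)
  moreover have "sqrt (2 * pi) * (exp (- (x / \<sigma>)\<^sup>2 / 2) /\<^sub>R \<bar>2 * pi * \<sigma>\<bar>) = normal_density 0 \<sigma> x"
  proof -
    have "- (x / \<sigma>)\<^sup>2 / 2 = - (x - 0)\<^sup>2 / (2 * \<sigma>\<^sup>2)"
      by (simp add: power_divide)
    moreover have "sqrt (2 * pi) / (2 * pi * \<sigma>) = 1 / sqrt (2 * pi * \<sigma>\<^sup>2)"
    proof -
      have r: "r / (r * r * \<sigma>) = 1 / (r * \<sigma>)" if "r \<noteq> 0" for r
        using that by simp
      have q: "sqrt (2 * pi) * sqrt (2 * pi) = 2 * pi" "sqrt (2 * pi) \<noteq> 0" by simp_all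
      have "sqrt (2 * pi * \<sigma>\<^sup>2) = sqrt (2 * pi) * \<sigma>"
        using assms by (simp add: real_sqrt_mult)
      then show ?thesis
        using r[OF q(2)] by (simp only: q(1))
    qed
    moreover have "sqrt (2 * pi) * (exp (- (x / \<sigma>)\<^sup>2 / 2) /\<^sub>R \<bar>2 * pi * \<sigma>\<bar>)
      = sqrt (2 * pi) / (2 * pi * \<sigma>) * exp (- (x / \<sigma>)\<^sup>2 / 2)"
    proof -
      have "S * (X /\<^sub>R \<bar>c\<bar>) = S / c * X" if "c > 0" for S X c :: real
        using that by (simp add: divide_inverse)
      from this[of "2 * pi * \<sigma>"] show ?thesis using assms by (simp only: mult_pos_pos pi_gt_zero zero_less_numeral)
    qed
    ultimately show ?thesis
      unfolding normal_density_def by (simp only:)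
  qed
  ultimately show "has_bochner_integral lborel (\<lambda>t. gauss_weight \<sigma> t * cos (2 * pi * x * t)) (normal_density 0 \<sigma> x)"
    by (simp only: w' arg add_0_left)
  have "has_bochner_integral lborel (\<lambda>t. sqrt (2 * pi) * (std_normal_density (0 + 2 * pi * \<sigma> * t) * sin (x / \<sigma> * (0 + 2 * pi * \<sigma> * t))))
    (sqrt (2 * pi) * (0 /\<^sub>R \<bar>2 * pi * \<sigma>\<bar>))"
    by (intro has_bochner_integral_mult_right lborel_has_bochner_integral_real_affine_iff[OF c,
          of "\<lambda>v. std_normal_density v * sin (x / \<sigma> * v)", THEN iffD1] fourier_std_normal_density)
  then show "has_bochner_integral lborel (\<lambda>t. gauss_weight \<sigma> t * sin (2 * pi * x * t)) 0"
    by (simp only: w' arg add_0_left scaleR_zero_right mult_zero_right)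
qed

section \<open>Damping and kernel in the plane\<close>

definition gauss_weight2 :: "real \<Rightarrow> real^2 \<Rightarrow> real" where
  "gauss_weight2 \<sigma> \<omega> = gauss_weight \<sigma> (\<omega> $ 1) * gauss_weight \<sigma> (\<omega> $ 2)"

text \<open>The Fourier transform of \<open>gauss_weight2 \<sigma>\<close>: a probability density
  that concentrates at 0 as \<open>\<sigma>\<close> tends to 0.\<close>

definition gauss_kernel :: "real \<Rightarrow> real^2 \<Rightarrow> real" where
  "gauss_kernel \<sigma> u = normal_density 0 \<sigma> (u $ 1) * normal_density 0 \<sigma> (u $ 2)"

lemma borel_measurable_gauss [measurable]:
  "gauss_weight2 \<sigma> \<in> borel_measurable borel" "gauss_kernel \<sigma> \<in> borel_measurable borel"
  unfolding gauss_weight2_def gauss_kernel_def by measurable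

lemma gauss_weight2_bounds: "0 \<le> gauss_weight2 \<sigma> \<omega>" "gauss_weight2 \<sigma> \<omega> \<le> 1"
  by (auto simp: gauss_weight2_def gauss_weight_def intro!: mult_le_one)

lemma integrable_gauss_weight2:
  assumes "\<sigma> > 0" shows "integrable lborel (gauss_weight2 \<sigma>)"
  using has_bochner_integral_real2[of "gauss_weight \<sigma>" "gauss_weight \<sigma>"] fourier_gauss_weight(1)[OF assms, of 0]
  by (simp add: has_bochner_integral_iff gauss_weight2_def[abs_def])

lemma gauss_kernel_nonneg: "0 \<le> gauss_kernel \<sigma> u"
  by (simp add: gauss_kernel_def)

lemma has_bochner_integral_gauss_kernel:
  assumes "\<sigma> > 0"
  shows "has_bochner_integral lborel (gauss_kernel \<sigma>) 1"
  using has_bochner_integral_real2[of "normal_density 0 \<sigma>" "normal_density 0 \<sigma>"] assms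
  by (simp add: gauss_kernel_def[abs_def])

lemma nn_integral_gauss_kernel:
  assumes "\<sigma> > 0"
  shows "(\<integral>\<^sup>+u. gauss_kernel \<sigma> u \<partial>lborel) = 1"
  using has_bochner_integral_gauss_kernel[OF assms]
  by (simp add: nn_integral_eq_integral gauss_kernel_nonneg has_bochner_integral_iff)

lemma gauss_kernel_scaleR:
  assumes "\<sigma> > 0"
  shows "gauss_kernel \<sigma> (\<sigma> *\<^sub>R u) = gauss_kernel 1 u / \<sigma>\<^sup>2"
  using assms
  by (simp add: gauss_kernel_def normal_density_def real_sqrt_mult power_mult_distrib power2_eq_square)

text \<open>At fixed \<open>b\<close> the Gabor transform is this transform of
  \<open>f x * quat_cnj (\<phi> (x - b))\<close>. Integration is over \<open>lborel\<close>, where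
  Fubini's theorem applies to Borel functions.\<close>

definition qft :: "(real^2 \<Rightarrow> quat) \<Rightarrow> real^2 \<Rightarrow> quat" where
  "qft h \<omega> = (\<integral>x. exp (- (2 * pi * (x $ 1) * (\<omega> $ 1)) *\<^sub>R quat_i) * h x *
     exp (- (2 * pi * (x $ 2) * (\<omega> $ 2)) *\<^sub>R quat_j) \<partial>lborel)"

text \<open>Every term with a sine factor integrates to 0. Only the product of the two cosine
  transforms remains, and its coefficient \<open>inner p q\<close> is free of \<open>quat_i\<close>
  and \<open>quat_j\<close>.\<close>

lemma has_bochner_integral_gauss_weight2_inner:
  fixes a b :: "real^2"
  assumes "\<sigma> > 0"
  shows "has_bochner_integral lborel
    (\<lambda>\<omega>. gauss_weight2 \<sigma> \<omega> * inner
      (exp (- (2 * pi * (a $ 1) * (\<omega> $ 1)) *\<^sub>R quat_i) * p * exp (- (2 * pi * (a $ 2) * (\<omega> $ 2)) *\<^sub>R quat_j))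
      (exp (- (2 * pi * (b $ 1) * (\<omega> $ 1)) *\<^sub>R quat_i) * q * exp (- (2 * pi * (b $ 2) * (\<omega> $ 2)) *\<^sub>R quat_j)))
    (gauss_kernel \<sigma> (b - a) * inner p q)"
proof -
  define d where "d = b - a"
  have ang: "- (2 * pi * (a $ i) * t) - - (2 * pi * (b $ i) * t) = 2 * pi * (d $ i) * t" for i t
    by (simp add: d_def algebra_simps)
  let ?c = "\<lambda>i t. gauss_weight \<sigma> t * cos (2 * pi * (d $ i) * t)"
  let ?s = "\<lambda>i t. gauss_weight \<sigma> t * sin (2 * pi * (d $ i) * t)"
  \<comment> \<open>The right exponentials are resolved first; after regrouping, the left rule acts
    on \<open>p\<close> and on \<open>p * quat_j\<close>, which gives one term for each choice of
    cosine or sine in the two coordinates.\<close>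
  have eq: "gauss_weight2 \<sigma> \<omega> * inner
      (exp (- (2 * pi * (a $ 1) * (\<omega> $ 1)) *\<^sub>R quat_i) * p * exp (- (2 * pi * (a $ 2) * (\<omega> $ 2)) *\<^sub>R quat_j))
      (exp (- (2 * pi * (b $ 1) * (\<omega> $ 1)) *\<^sub>R quat_i) * q * exp (- (2 * pi * (b $ 2) * (\<omega> $ 2)) *\<^sub>R quat_j))
    = ?c 1 (\<omega> $ 1) * ?c 2 (\<omega> $ 2) * inner p q + ?s 1 (\<omega> $ 1) * ?c 2 (\<omega> $ 2) * inner (quat_i * p) q
    + (?c 1 (\<omega> $ 1) * ?s 2 (\<omega> $ 2) * inner (p * quat_j) q + ?s 1 (\<omega> $ 1) * ?s 2 (\<omega> $ 2) * inner (quat_i * (p * quat_j)) q)" for \<omega>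
    unfolding inner_exp_quat_j mult.assoc[of _ p quat_j] inner_exp_quat_i ang gauss_weight2_def
    by (simp add: algebra_simps)
  have I: "has_bochner_integral lborel (?c i) (normal_density 0 \<sigma> (d $ i))" "has_bochner_integral lborel (?s i) 0" for i
    using fourier_gauss_weight[OF assms] by auto
  have P: "has_bochner_integral lborel (\<lambda>\<omega>::real^2. f (\<omega> $ 1) * g (\<omega> $ 2)) (x * y)"
    if "has_bochner_integral lborel f x" "has_bochner_integral lborel g y" for f g :: "real \<Rightarrow> real" and x y
    using has_bochner_integral_real2[of f g] that by (auto simp: has_bochner_integral_iff)
  have "has_bochner_integral lborel (\<lambda>\<omega>::real^2.
      ?c 1 (\<omega> $ 1) * ?c 2 (\<omega> $ 2) * inner p q + ?s 1 (\<omega> $ 1) * ?c 2 (\<omega> $ 2) * inner (quat_i * p) q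
    + (?c 1 (\<omega> $ 1) * ?s 2 (\<omega> $ 2) * inner (p * quat_j) q + ?s 1 (\<omega> $ 1) * ?s 2 (\<omega> $ 2) * inner (quat_i * (p * quat_j)) q))
    (normal_density 0 \<sigma> (d $ 1) * normal_density 0 \<sigma> (d $ 2) * inner p q + 0 * normal_density 0 \<sigma> (d $ 2) * inner (quat_i * p) q
    + (normal_density 0 \<sigma> (d $ 1) * 0 * inner (p * quat_j) q + 0 * 0 * inner (quat_i * (p * quat_j)) q))"
    by (intro has_bochner_integral_add has_bochner_integral_mult_left P I)
  then show ?thesis
    unfolding eq by (simp add: gauss_kernel_def d_def)
qed

text \<open>The squared norm of the transform is a double integral of inner products, so Fubini may
  integrate over the frequency first. The damping, together with Cauchy-Schwarz, makes the triple
  integrand \<open>\<Psi>\<close> absolutely integrable.\<close>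

lemma qft_gauss_parseval:
  assumes \<sigma>: "\<sigma> > 0" and h: "integrable lborel h"
  shows "integrable lborel (\<lambda>\<omega>. gauss_weight2 \<sigma> \<omega> * (norm (qft h \<omega>))\<^sup>2)"
    and "(\<integral>\<omega>. gauss_weight2 \<sigma> \<omega> * (norm (qft h \<omega>))\<^sup>2 \<partial>lborel) =
      (\<integral>p. gauss_kernel \<sigma> (snd p - fst p) * inner (h (fst p)) (h (snd p)) \<partial>lborel)"
proof -
  have [measurable]: "h \<in> borel_measurable borel"
    using h by (auto dest: borel_measurable_integrable)
  define F where "F \<omega> x = exp (- (2 * pi * (x $ 1) * (\<omega> $ 1)) *\<^sub>R quat_i) * h x *
     exp (- (2 * pi * (x $ 2) * (\<omega> $ 2)) *\<^sub>R quat_j)" for \<omega> x :: "real^2"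
  have Fm [measurable (raw)]: "(\<lambda>z. F (f z) (g z)) \<in> borel_measurable M"
    if [measurable]: "f \<in> borel_measurable M" "g \<in> borel_measurable M" for f g and M :: "'z measure"
    unfolding F_def by measurable
  have nF: "norm (F \<omega> x) = norm (h x)" for \<omega> x
    by (simp add: F_def norm_mult del: scaleR_minus_left)
  have qft_F: "qft h \<omega> = (\<integral>x. F \<omega> x \<partial>lborel)" for \<omega>
    by (simp only: qft_def F_def)
  have Fi: "integrable lborel (F \<omega>)" for \<omega>
    by (rule Bochner_Integration.integrable_bound[OF h]) (auto simp: nF)
  define \<Psi> where "\<Psi> \<omega> p = gauss_weight2 \<sigma> \<omega> * inner (F \<omega> (fst p)) (F \<omega> (snd p))"
    for \<omega> and p :: "(real^2) \<times> (real^2)"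
  have "integrable lborel (\<lambda>p. norm (h (fst p)) * norm (h (snd p)))"
    using has_bochner_integral_bilinear_pair[OF bounded_bilinear_mult integrable_norm[OF h] integrable_norm[OF h]]
    by (simp add: has_bochner_integral_iff)
  from has_bochner_integral_bilinear_pair[OF bounded_bilinear_mult integrable_gauss_weight2[OF \<sigma>] this]
  have dom: "integrable lborel (\<lambda>z::(real^2) \<times> ((real^2) \<times> (real^2)). gauss_weight2 \<sigma> (fst z) * (norm (h (fst (snd z))) * norm (h (snd (snd z)))))"
    by (simp add: has_bochner_integral_iff)
  have "integrable lborel (\<lambda>z::(real^2) \<times> ((real^2) \<times> (real^2)). \<Psi> (fst z) (snd z))"
  proof (rule Bochner_Integration.integrable_bound[OF dom])
    show "(\<lambda>z::(real^2) \<times> ((real^2) \<times> (real^2)). \<Psi> (fst z) (snd z)) \<in> borel_measurable lborel"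
    proof -
      have [measurable]: "(\<lambda>z. fst z) \<in> borel_measurable (borel :: ((real^2) \<times> ((real^2) \<times> (real^2))) measure)"
        "(\<lambda>z. fst (snd z)) \<in> borel_measurable (borel :: ((real^2) \<times> ((real^2) \<times> (real^2))) measure)"
        "(\<lambda>z. snd (snd z)) \<in> borel_measurable (borel :: ((real^2) \<times> ((real^2) \<times> (real^2))) measure)"
        by (auto intro!: borel_measurable_continuous_onI continuous_intros)
      show ?thesis
        unfolding \<Psi>_def by measurable
    qed
    have "norm (\<Psi> \<omega> p) \<le> norm (gauss_weight2 \<sigma> \<omega> * (norm (h (fst p)) * norm (h (snd p))))" for \<omega> p
      using gauss_weight2_bounds[of \<sigma> \<omega>] Cauchy_Schwarz_ineq2[of "F \<omega> (fst p)" "F \<omega> (snd p)"]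
      by (auto simp: \<Psi>_def abs_mult nF intro!: mult_left_mono)
    then show "AE z in lborel. norm (\<Psi> (fst z) (snd z)) \<le> norm (gauss_weight2 \<sigma> (fst z) * (norm (h (fst (snd z))) * norm (h (snd (snd z)))))"
      by auto
  qed
  then have int: "integrable (lborel \<Otimes>\<^sub>M lborel) (\<lambda>(\<omega>, p). \<Psi> \<omega> p)"
    by (simp add: lborel_prod case_prod_beta')
  have 1: "(\<integral>p. \<Psi> \<omega> p \<partial>lborel) = gauss_weight2 \<sigma> \<omega> * (norm (qft h \<omega>))\<^sup>2" for \<omega>
    using has_bochner_integral_bilinear_pair[OF bounded_bilinear_inner Fi[of \<omega>] Fi[of \<omega>]]
    by (simp add: has_bochner_integral_iff \<Psi>_def qft_F power2_norm_eq_inner)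
  have 2: "(\<integral>\<omega>. \<Psi> \<omega> p \<partial>lborel) = gauss_kernel \<sigma> (snd p - fst p) * inner (h (fst p)) (h (snd p))" for p
    using has_bochner_integral_gauss_weight2_inner[OF \<sigma>, of "fst p" "h (fst p)" "snd p" "h (snd p)"]
    by (simp add: has_bochner_integral_iff \<Psi>_def F_def)
  show "integrable lborel (\<lambda>\<omega>. gauss_weight2 \<sigma> \<omega> * (norm (qft h \<omega>))\<^sup>2)"
    using lborel_pair.integrable_fst[OF int] by (simp only: 1)
  show "(\<integral>\<omega>. gauss_weight2 \<sigma> \<omega> * (norm (qft h \<omega>))\<^sup>2 \<partial>lborel) =
      (\<integral>p. gauss_kernel \<sigma> (snd p - fst p) * inner (h (fst p)) (h (snd p)) \<partial>lborel)"
    using lborel_pair.Fubini_integral[OF int] by (simp only: 1 2)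
qed

section \<open>From the damped identity to the Plancherel inequality\<close>

lemma nn_integral_lborel_pair:
  fixes f :: "'a::euclidean_space \<times> 'b::euclidean_space \<Rightarrow> ennreal"
  assumes "f \<in> borel_measurable borel"
  shows "(\<integral>\<^sup>+p. f p \<partial>lborel) = (\<integral>\<^sup>+x. \<integral>\<^sup>+y. f (x, y) \<partial>lborel \<partial>lborel)"
    and "(\<integral>\<^sup>+p. f p \<partial>lborel) = (\<integral>\<^sup>+y. \<integral>\<^sup>+x. f (x, y) \<partial>lborel \<partial>lborel)"
proof -
  have f: "f \<in> borel_measurable (lborel \<Otimes>\<^sub>M lborel)"
    using assms by (simp add: lborel_prod)
  show "(\<integral>\<^sup>+p. f p \<partial>lborel) = (\<integral>\<^sup>+x. \<integral>\<^sup>+y. f (x, y) \<partial>lborel \<partial>lborel)"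
    using lborel.nn_integral_fst[OF f] by (simp add: lborel_prod)
  show "(\<integral>\<^sup>+p. f p \<partial>lborel) = (\<integral>\<^sup>+y. \<integral>\<^sup>+x. f (x, y) \<partial>lborel \<partial>lborel)"
    using lborel_pair.nn_integral_snd[OF f] by (simp add: lborel_prod)
qed

lemma borel_measurable_fst_snd [measurable]:
  "fst \<in> borel_measurable (borel :: ('a::euclidean_space \<times> 'b::euclidean_space) measure)"
  "snd \<in> borel_measurable (borel :: ('a::euclidean_space \<times> 'b::euclidean_space) measure)"
  by (auto intro!: borel_measurable_continuous_onI continuous_intros)

lemma norm_diff_power2_le_sum:
  fixes a b :: "'a::real_inner"
  shows "(norm (a - b))\<^sup>2 \<le> 2 * (norm a)\<^sup>2 + 2 * (norm b)\<^sup>2"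
proof -
  have "0 \<le> (norm (a + b))\<^sup>2" by simp
  then show ?thesis by (simp add: power2_norm_eq_inner inner_diff inner_add inner_commute)
qed

text \<open>The damped identity is rewritten by polarization. As the kernel has mass 1,
  \<open>a\<close> and \<open>b\<close> both integrate to the squared norm of \<open>h\<close>,
  while \<open>d\<close> collects the squared differences.\<close>

lemma qft_bessel_defect:
  assumes \<sigma>: "\<sigma> > 0" and h: "integrable lborel h"
    and fin: "(\<integral>\<^sup>+x. (norm (h x))\<^sup>2 \<partial>lborel) < \<infinity>"
  shows "(\<integral>\<^sup>+x. (norm (h x))\<^sup>2 \<partial>lborel) \<le> (\<integral>\<^sup>+\<omega>. (norm (qft h \<omega>))\<^sup>2 \<partial>lborel) +
    (\<integral>\<^sup>+u. gauss_kernel \<sigma> u * (\<integral>\<^sup>+x. (norm (h (x + u) - h x))\<^sup>2 \<partial>lborel) \<partial>lborel)"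
    (is "?N \<le> ?Q + ?R")
proof -
  have [measurable]: "h \<in> borel_measurable borel"
    using h by (auto dest: borel_measurable_integrable)
  define a where "a p = gauss_kernel \<sigma> (snd p - fst p) * (norm (h (fst p)))\<^sup>2" for p
  define b where "b p = gauss_kernel \<sigma> (snd p - fst p) * (norm (h (snd p)))\<^sup>2" for p
  define d where "d p = gauss_kernel \<sigma> (snd p - fst p) * (norm (h (snd p) - h (fst p)))\<^sup>2" for p
  have [measurable]: "a \<in> borel_measurable borel" "b \<in> borel_measurable borel" "d \<in> borel_measurable borel"
    unfolding a_def b_def d_def by measurable
  have nonneg: "0 \<le> a p" "0 \<le> b p" "0 \<le> d p" for p
    by (auto simp: a_def b_def d_def gauss_kernel_nonneg)
  have ker: "(\<integral>\<^sup>+y. gauss_kernel \<sigma> (y - x) \<partial>lborel) = 1" "(\<integral>\<^sup>+y. gauss_kernel \<sigma> (x - y) \<partial>lborel) = 1" for x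
    using nn_integral_lborel_translation[of "\<lambda>u. ennreal (gauss_kernel \<sigma> u)" "- x"]
      nn_integral_lborel_reflect[of "\<lambda>u. ennreal (gauss_kernel \<sigma> u)" x] nn_integral_gauss_kernel[OF \<sigma>] by auto
  have A: "(\<integral>\<^sup>+p. a p \<partial>lborel) = ?N"
    by (subst nn_integral_lborel_pair(1))
       (simp_all add: a_def gauss_kernel_nonneg ennreal_mult nn_integral_multc ker)
  have B: "(\<integral>\<^sup>+p. b p \<partial>lborel) = ?N"
    by (subst nn_integral_lborel_pair(2))
       (simp_all add: b_def gauss_kernel_nonneg ennreal_mult nn_integral_multc ker)
  have D: "(\<integral>\<^sup>+p. d p \<partial>lborel) = ?R"
  proof -
    let ?d = "\<lambda>x y. ennreal (gauss_kernel \<sigma> (y - x)) * ennreal ((norm (h y - h x))\<^sup>2)"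
    have "(\<integral>\<^sup>+p. d p \<partial>lborel) = (\<integral>\<^sup>+x. \<integral>\<^sup>+y. ?d x y \<partial>lborel \<partial>lborel)"
      by (subst nn_integral_lborel_pair(1)) (simp_all add: d_def gauss_kernel_nonneg ennreal_mult)
    \<comment> \<open>Substituting \<open>y = u + x\<close> makes the kernel a function of
      \<open>u\<close> alone.\<close>
    also have "\<dots> = (\<integral>\<^sup>+x. \<integral>\<^sup>+u. ?d x (u + x) \<partial>lborel \<partial>lborel)"
      by (intro nn_integral_cong nn_integral_lborel_translation[symmetric]) measurable
    also have "\<dots> = (\<integral>\<^sup>+u. \<integral>\<^sup>+x. ?d x (u + x) \<partial>lborel \<partial>lborel)"
      by (rule lborel_pair.Fubini') measurable
    also have "\<dots> = ?R"
      by (simp add: nn_integral_cmult add.commute)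
    finally show ?thesis .
  qed
  \<comment> \<open>This makes \<open>d\<close> integrable, so that the three integrals can be
    separated as real numbers.\<close>
  have dle: "d p \<le> 2 * (a p + b p)" for p
    using mult_left_mono[OF norm_diff_power2_le_sum[of "h (snd p)" "h (fst p)"] gauss_kernel_nonneg[of \<sigma> "snd p - fst p"]]
    by (simp add: a_def b_def d_def algebra_simps)
  have ia: "integrable lborel a" and ib: "integrable lborel b"
    using fin A B nonneg by (simp_all add: integrable_iff_bounded)
  have id: "integrable lborel d"
    by (rule Bochner_Integration.integrable_bound[of _ "\<lambda>p. 2 * (a p + b p)"]) (use ia ib nonneg dle in auto)
  define J where "J = (\<integral>\<omega>. gauss_weight2 \<sigma> \<omega> * (norm (qft h \<omega>))\<^sup>2 \<partial>lborel)"
  \<comment> \<open>Polarization of the inner product.\<close>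
  have "gauss_kernel \<sigma> (snd p - fst p) * inner (h (fst p)) (h (snd p)) = (a p + b p - d p) / 2" for p :: "(real^2) \<times> (real^2)"
    by (simp add: a_def b_def d_def power2_norm_eq_inner inner_diff inner_commute algebra_simps)
  then have "J = ((\<integral>p. a p \<partial>lborel) + (\<integral>p. b p \<partial>lborel) - (\<integral>p. d p \<partial>lborel)) / 2"
    using ia ib id by (simp only: J_def qft_gauss_parseval(2)[OF \<sigma> h]) simp
  moreover have "(\<integral>p. a p \<partial>lborel) = (\<integral>p. b p \<partial>lborel)"
    using nonneg by (simp add: integral_eq_nn_integral A B)
  ultimately have eq: "(\<integral>p. a p \<partial>lborel) = J + (\<integral>p. d p \<partial>lborel) / 2" by simp
  have J0: "0 \<le> J"
    unfolding J_def by (intro Bochner_Integration.integral_nonneg) (simp add: gauss_weight2_bounds)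
  have "ennreal J = (\<integral>\<^sup>+\<omega>. gauss_weight2 \<sigma> \<omega> * (norm (qft h \<omega>))\<^sup>2 \<partial>lborel)"
    unfolding J_def using qft_gauss_parseval(1)[OF \<sigma> h]
    by (subst nn_integral_eq_integral) (auto simp: gauss_weight2_bounds)
  also have "\<dots> \<le> ?Q"
    using gauss_weight2_bounds by (intro nn_integral_mono ennreal_leI) (auto intro!: mult_left_le_one_le)
  finally have J: "ennreal J \<le> ?Q" .
  have "?N = ennreal (\<integral>p. a p \<partial>lborel)"
    using ia nonneg by (simp add: A[symmetric] nn_integral_eq_integral)
  \<comment> \<open>Half of the defect is enlarged to the whole of it, which is nonnegative.\<close>
  also have "\<dots> \<le> ennreal (J + (\<integral>p. d p \<partial>lborel))"
    unfolding eq using Bochner_Integration.integral_nonneg[of lborel d] nonneg by (intro ennreal_leI) simp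
  also have "\<dots> = ennreal J + ?R"
    using J0 id nonneg by (simp add: D[symmetric] nn_integral_eq_integral)
  finally show ?thesis
    using J by (meson add_right_mono order_trans)
qed

text \<open>Scaling by \<open>\<sigma>\<close> moves the parameter from the kernel into the shift.
  The kernel is then fixed, \<open>T\<close> is bounded by \<open>4 * ?N\<close>, and
  \<open>T\<close> at the shrinking shifts tends to 0 by continuity of translations in
  \<open>L^2\<close>, so dominated convergence applies.\<close>

lemma gauss_kernel_defect_tendsto_0:
  fixes h :: "real^2 \<Rightarrow> quat"
  assumes [measurable]: "h \<in> borel_measurable borel"
    and fin: "(\<integral>\<^sup>+x. (norm (h x))\<^sup>2 \<partial>lborel) < \<infinity>"
  shows "(\<lambda>n. \<integral>\<^sup>+u. gauss_kernel (inverse (real (Suc n))) u * (\<integral>\<^sup>+x. (norm (h (x + u) - h x))\<^sup>2 \<partial>lborel) \<partial>lborel) \<longlonglongrightarrow> 0"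
proof -
  define T where "T u = (\<integral>\<^sup>+x. (norm (h (x + u) - h x))\<^sup>2 \<partial>lborel)" for u
  have [measurable]: "T \<in> borel_measurable borel"
    unfolding T_def by measurable
  let ?N = "\<integral>\<^sup>+x. (norm (h x))\<^sup>2 \<partial>lborel"
  have T: "T u \<le> 4 * ?N" for u
  proof -
    have "T u \<le> (\<integral>\<^sup>+x. 2 * ennreal ((norm (h (x + u)))\<^sup>2) + 2 * ennreal ((norm (h x))\<^sup>2) \<partial>lborel)"
      unfolding T_def
    proof (rule nn_integral_mono)
      fix x
      have "ennreal ((norm (h (x + u) - h x))\<^sup>2) \<le> ennreal (2 * (norm (h (x + u)))\<^sup>2 + 2 * (norm (h x))\<^sup>2)"
        by (intro ennreal_leI norm_diff_power2_le_sum)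
      then show "ennreal ((norm (h (x + u) - h x))\<^sup>2) \<le> 2 * ennreal ((norm (h (x + u)))\<^sup>2) + 2 * ennreal ((norm (h x))\<^sup>2)"
        by (simp add: ennreal_mult)
    qed
    also have "\<dots> = 2 * (\<integral>\<^sup>+x. ennreal ((norm (h (x + u)))\<^sup>2) \<partial>lborel) + 2 * ?N"
      by (simp add: nn_integral_add nn_integral_cmult)
    also have "\<dots> = 2 * ?N + 2 * ?N"
      by (simp add: nn_integral_lborel_translation[of "\<lambda>x. ennreal ((norm (h x))\<^sup>2)"])
    also have "\<dots> = 4 * ?N"
      by (simp add: distrib_right[symmetric])
    finally show ?thesis .
  qed
  have scale: "(\<integral>\<^sup>+u. gauss_kernel \<sigma> u * T u \<partial>lborel) = (\<integral>\<^sup>+v. gauss_kernel 1 v * T (\<sigma> *\<^sub>R v) \<partial>lborel)" if "\<sigma> > 0" for \<sigma>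
  proof -
    have "ennreal (gauss_kernel 1 v) = ennreal (\<sigma>\<^sup>2) * ennreal (gauss_kernel \<sigma> (\<sigma> *\<^sub>R v))" for v
      using that by (simp add: gauss_kernel_scaleR ennreal_mult[symmetric] gauss_kernel_nonneg)
    then show ?thesis
      using that by (subst nn_integral_lborel_scaleR[of _ \<sigma>]) (simp_all add: nn_integral_cmult[symmetric] mult.assoc)
  qed
  have "(\<lambda>n. \<integral>\<^sup>+v. gauss_kernel 1 v * T (inverse (real (Suc n)) *\<^sub>R v) \<partial>lborel) \<longlonglongrightarrow> (\<integral>\<^sup>+v. 0 \<partial>(lborel :: (real^2) measure))"
  proof (rule nn_integral_dominated_convergence[where w = "\<lambda>v. ennreal (gauss_kernel 1 v) * (4 * ?N)"])
    show "AE v in lborel. ennreal (gauss_kernel 1 v) * T (inverse (real (Suc n)) *\<^sub>R v) \<le> ennreal (gauss_kernel 1 v) * (4 * ?N)" for n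
      by (intro AE_I2 mult_left_mono T) simp
    show "(\<integral>\<^sup>+v. ennreal (gauss_kernel 1 v) * (4 * ?N) \<partial>lborel) < \<infinity>"
      using fin by (simp add: nn_integral_multc nn_integral_gauss_kernel ennreal_mult_less_top)
    show "AE v in lborel. (\<lambda>n. ennreal (gauss_kernel 1 v) * T (inverse (real (Suc n)) *\<^sub>R v)) \<longlonglongrightarrow> 0"
    proof (rule AE_I2)
      fix v :: "real^2"
      have "(\<lambda>n. inverse (real (Suc n)) *\<^sub>R v) \<longlonglongrightarrow> 0 *\<^sub>R v"
        by (intro tendsto_scaleR LIMSEQ_inverse_real_of_nat tendsto_const)
      then have "(\<lambda>n. T (inverse (real (Suc n)) *\<^sub>R v)) \<longlonglongrightarrow> 0"
        unfolding T_def using fin by (intro translation_L2_tendsto_0) simp_all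
      then show "(\<lambda>n. ennreal (gauss_kernel 1 v) * T (inverse (real (Suc n)) *\<^sub>R v)) \<longlonglongrightarrow> 0"
        using ennreal_tendsto_cmult[of "ennreal (gauss_kernel 1 v)"] by fastforce
    qed
  qed measurable
  then have "(\<lambda>n. \<integral>\<^sup>+u. gauss_kernel (inverse (real (Suc n))) u * T u \<partial>lborel) \<longlonglongrightarrow> 0"
    by (simp add: scale del: of_nat_Suc)
  then show ?thesis
    by (simp only: T_def)
qed

text \<open>Neither side depends on \<open>\<sigma>\<close>, so the defect disappears along
  \<open>\<sigma> = 1 / (n + 1)\<close>.\<close>

lemma qft_bessel:
  assumes h: "integrable lborel h" and fin: "(\<integral>\<^sup>+x. (norm (h x))\<^sup>2 \<partial>lborel) < \<infinity>"
  shows "(\<integral>\<^sup>+x. (norm (h x))\<^sup>2 \<partial>lborel) \<le> (\<integral>\<^sup>+\<omega>. (norm (qft h \<omega>))\<^sup>2 \<partial>lborel)"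
proof (rule LIMSEQ_le_const)
  let ?Q = "\<integral>\<^sup>+\<omega>. (norm (qft h \<omega>))\<^sup>2 \<partial>lborel"
  let ?R = "\<lambda>n. \<integral>\<^sup>+u. gauss_kernel (inverse (real (Suc n))) u * (\<integral>\<^sup>+x. (norm (h (x + u) - h x))\<^sup>2 \<partial>lborel) \<partial>lborel"
  have "?R \<longlonglongrightarrow> 0"
    using h by (intro gauss_kernel_defect_tendsto_0 fin) (auto dest: borel_measurable_integrable)
  from tendsto_add[OF tendsto_const[of ?Q] this] show "(\<lambda>n. ?Q + ?R n) \<longlonglongrightarrow> ?Q"
    by (simp only: add_0_right)
qed (use qft_bessel_defect[OF _ h fin] in auto)

section \<open>The windowed transform\<close>

text \<open>Each coordinate has a Borel representative, and the finitely many exceptional null sets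
  unite to a null set. Borel representatives are what the product measure arguments require.\<close>

lemma lebesgue_ex_borel_measurable:
  fixes g :: "'a::euclidean_space \<Rightarrow> 'b::euclidean_space"
  assumes g: "g \<in> borel_measurable lebesgue"
  obtains g' where "g' \<in> borel_measurable borel" "AE x in lborel. g x = g' x"
proof -
  have "\<exists>g'\<in>borel_measurable lborel. AE x in lborel. g x \<bullet> i = g' x" for i
    using g by (intro completion_ex_borel_measurable_real) auto
  then have "\<forall>i. \<exists>g'. g' \<in> borel_measurable borel \<and> (AE x in lborel. g x \<bullet> i = g' x)"
    by (simp add: Bex_def)
  from choice[OF this]
  obtain G where G: "\<And>i. G i \<in> borel_measurable borel" "\<And>i. AE x in lborel. g x \<bullet> i = G i x"
    by blast
  have "AE x in lborel. \<forall>i\<in>Basis. g x \<bullet> i = G i x"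
    using G(2) by (intro AE_finite_allI) auto
  then have "AE x in lborel. g x = (\<Sum>i\<in>Basis. G i x *\<^sub>R i)"
  proof eventually_elim
    case (elim x)
    then show ?case by (subst euclidean_representation[symmetric]) simp
  qed
  moreover have "(\<lambda>x. \<Sum>i\<in>Basis. G i x *\<^sub>R i) \<in> borel_measurable borel"
    using G(1) by measurable
  ultimately show thesis using that by blast
qed

lemma AE_lborel_translation:
  fixes a :: "'a::euclidean_space"
  assumes "AE x in lborel. P x"
  shows "AE x in lborel. P (x + a)"
proof -
  have "AE x in distr lborel borel ((+) a). P x"
    using assms by (simp only: lborel_distr_plus)
  then have "AE x in lborel. P (a + x)"
    by (rule AE_distrD[rotated]) simp
  then show ?thesis by (simp add: add.commute)
qed

section \<open>The Cauchy-Schwarz inequality for nonnegative integrals\<close>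

lemma sq_le_mult_of_scaled_AM_GM:
  fixes a b i :: real
  assumes "0 \<le> a" "0 \<le> b" "0 \<le> i" and *: "\<And>t. 0 < t \<Longrightarrow> 2 * i \<le> t * a + b / t"
  shows "i\<^sup>2 \<le> a * b"
proof (cases "i = 0")
  case False
  with assms have i: "0 < i" by simp
  show ?thesis
  proof (cases "a = 0")
    case True
    \<comment> \<open>With \<open>a = 0\<close> this \<open>t\<close> is large enough to push
      \<open>b / t\<close> below \<open>i\<close>, a contradiction.\<close>
    have "2 * i \<le> b / ((b + 1) / i)"
      using *[of "(b + 1) / i"] True i assms(2) by simp
    also have "\<dots> < i"
      using i assms(2) by (simp add: divide_simps)
    finally show ?thesis using i by simp
  next
    case False
    with assms have a: "0 < a" by simp
    \<comment> \<open>The choice \<open>t = i / a\<close> turns the first summand into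
      \<open>i\<close>, which cancels against the left side.\<close>
    have "2 * i \<le> i + a * b / i"
      using *[of "i / a"] i a by (simp add: mult.commute)
    then show ?thesis
      using i by (simp add: field_simps power2_eq_square)
  qed
qed (use assms in simp)

text \<open>The pointwise bound
  \<open>2 * (f x * g x) \<le> t * (f x)\<^sup>2 + (g x)\<^sup>2 / t\<close> is integrated and then
  optimised over \<open>t\<close>.\<close>

lemma nn_integral_Cauchy_Schwarz:
  fixes f g :: "'a \<Rightarrow> real"
  assumes [measurable]: "f \<in> borel_measurable M" "g \<in> borel_measurable M"
    and nonneg: "\<And>x. 0 \<le> f x" "\<And>x. 0 \<le> g x"
    and fin: "(\<integral>\<^sup>+x. (f x)\<^sup>2 \<partial>M) < \<infinity>" "(\<integral>\<^sup>+x. (g x)\<^sup>2 \<partial>M) < \<infinity>"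
  shows "(\<integral>\<^sup>+x. f x * g x \<partial>M)\<^sup>2 \<le> (\<integral>\<^sup>+x. (f x)\<^sup>2 \<partial>M) * (\<integral>\<^sup>+x. (g x)\<^sup>2 \<partial>M)"
proof -
  obtain a b where a: "(\<integral>\<^sup>+x. (f x)\<^sup>2 \<partial>M) = ennreal a" "0 \<le> a" and b: "(\<integral>\<^sup>+x. (g x)\<^sup>2 \<partial>M) = ennreal b" "0 \<le> b"
    using fin unfolding infinity_ennreal_def less_top_ennreal by blast
  have amgm: "2 * (\<integral>\<^sup>+x. f x * g x \<partial>M) \<le> ennreal (t * a + b / t)" if t: "t > 0" for t
  proof -
    have "2 * (f x * g x) \<le> t * (f x)\<^sup>2 + (g x)\<^sup>2 / t" for x
    proof -
      have "0 \<le> (t * f x - g x)\<^sup>2 / t" using t by simp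
      then show ?thesis using t by (simp add: power2_eq_square field_simps)
    qed
    then have "(\<integral>\<^sup>+x. ennreal (2 * (f x * g x)) \<partial>M) \<le> (\<integral>\<^sup>+x. ennreal (t * (f x)\<^sup>2 + (g x)\<^sup>2 / t) \<partial>M)"
      by (intro nn_integral_mono ennreal_leI)
    also have "\<dots> = (\<integral>\<^sup>+x. ennreal t * ennreal ((f x)\<^sup>2) + ennreal (1 / t) * ennreal ((g x)\<^sup>2) \<partial>M)"
      using t by (intro nn_integral_cong) (simp add: ennreal_mult[symmetric])
    also have "\<dots> = ennreal t * ennreal a + ennreal (1 / t) * ennreal b"
      by (simp add: nn_integral_add nn_integral_cmult a b)
    also have "\<dots> = ennreal (t * a + b / t)"
      using t a b by (simp add: ennreal_mult[symmetric])
    finally show ?thesis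
      using nonneg by (simp add: ennreal_mult nn_integral_cmult)
  qed
  \<comment> \<open>The instance \<open>t = 1\<close> already gives finiteness, which permits the
    passage to real numbers.\<close>
  have "2 * (\<integral>\<^sup>+x. f x * g x \<partial>M) < top"
    using amgm[of 1] by (auto intro: le_less_trans)
  then have "(\<integral>\<^sup>+x. f x * g x \<partial>M) < top"
    by (auto simp: ennreal_mult_less_top)
  then obtain i where i: "(\<integral>\<^sup>+x. f x * g x \<partial>M) = ennreal i" "0 \<le> i"
    unfolding less_top_ennreal by blast
  have "i\<^sup>2 \<le> a * b"
  proof (rule sq_le_mult_of_scaled_AM_GM)
    fix t :: real assume "0 < t"
    then have "ennreal (2 * i) \<le> ennreal (t * a + b / t)"
      using amgm[of t] i by (simp add: ennreal_mult)
    then show "2 * i \<le> t * a + b / t"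
      using \<open>0 < t\<close> a b by (subst (asm) ennreal_le_iff) auto
  qed (use a b i in auto)
  then show ?thesis
    using a b i by (simp add: ennreal_power ennreal_mult[symmetric])
qed

text \<open>Translates of null sets are null, so for each fixed \<open>b\<close> the integrand
  changes only on a null set. The equality therefore holds at every point of phase space.\<close>

lemma gqft_eq_qft:
  assumes f: "f \<in> borel_measurable lebesgue" and f': "f' \<in> borel_measurable borel" "AE x in lborel. f x = f' x"
    and \<phi>': "\<phi>' \<in> borel_measurable borel" "AE x in lborel. \<phi> x = \<phi>' x"
  shows "gqft \<phi> f (\<omega>, b) = qft (\<lambda>x. f' x * quat_cnj (\<phi>' (x - b))) \<omega>"
proof -
  note [measurable] = f'(1) \<phi>'(1)
  let ?F = "\<lambda>f \<phi> x. exp (- (2 * pi * (x $ 1) * (\<omega> $ 1)) *\<^sub>R quat_i) * (f x * quat_cnj (\<phi> (x - b))) *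
     exp (- (2 * pi * (x $ 2) * (\<omega> $ 2)) *\<^sub>R quat_j)"
  have m: "?F f' \<phi>' \<in> borel_measurable borel" by measurable
  then have m': "?F f' \<phi>' \<in> borel_measurable lebesgue"
    by (auto intro: measurable_completion)
  have "AE x in lborel. ?F f' \<phi>' x = ?F f \<phi> x"
    using f'(2) AE_lborel_translation[OF \<phi>'(2), of "- b"] by eventually_elim simp
  then have ae: "AE x in lebesgue. ?F f' \<phi>' x = ?F f \<phi> x"
    by (rule AE_completion)
  have "gqft \<phi> f (\<omega>, b) = (\<integral>x. ?F f \<phi> x \<partial>lebesgue)"
    by (simp add: gqft_def mult.assoc)
  also have "\<dots> = (\<integral>x. ?F f' \<phi>' x \<partial>lebesgue)"
    using ae borel_measurable_AE[OF m' ae] m' by (intro integral_cong_AE) auto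
  also have "\<dots> = (\<integral>x. ?F f' \<phi>' x \<partial>lborel)"
    using m by (intro integral_completion) simp
  finally show ?thesis by (simp add: qft_def)
qed

text \<open>The exponentials have norm 1, so \<open>G\<close> is bounded by the \<open>L^1\<close>
  norm of \<open>h b\<close>; the lower estimate integrates the Plancherel inequality for
  \<open>h b\<close> over \<open>b\<close>.\<close>

lemma qft_window:
  fixes f \<phi> :: "real^2 \<Rightarrow> quat"
  assumes [measurable]: "f \<in> borel_measurable borel" "\<phi> \<in> borel_measurable borel"
    and fin: "(\<integral>\<^sup>+x. (norm (f x))\<^sup>2 \<partial>lborel) < \<infinity>" "(\<integral>\<^sup>+x. (norm (\<phi> x))\<^sup>2 \<partial>lborel) < \<infinity>"
  defines "G \<equiv> \<lambda>z. qft (\<lambda>x. f x * quat_cnj (\<phi> (x - snd z))) (fst z)"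
    and "E \<equiv> (\<integral>\<^sup>+x. (norm (f x))\<^sup>2 \<partial>lborel) * (\<integral>\<^sup>+x. (norm (\<phi> x))\<^sup>2 \<partial>lborel)"
  shows qft_window_measurable: "G \<in> borel_measurable borel"
    and qft_window_bound: "ennreal ((norm (G z))\<^sup>2) \<le> E"
    and qft_window_bessel: "E \<le> (\<integral>\<^sup>+z. (norm (G z))\<^sup>2 \<partial>lborel)"
proof -
  define h where "h b x = f x * quat_cnj (\<phi> (x - b))" for b x
  have [measurable]: "h b \<in> borel_measurable borel" for b
    unfolding h_def by measurable
  have nh: "norm (h b x) = norm (f x) * norm (\<phi> (x - b))" for b x
    by (simp add: h_def norm_mult)
  have G: "G (\<omega>, b) = qft (h b) \<omega>" for \<omega> b
    by (simp add: G_def h_def[abs_def])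
  have trans: "(\<integral>\<^sup>+x. (norm (\<phi> (x - b)))\<^sup>2 \<partial>lborel) = (\<integral>\<^sup>+x. (norm (\<phi> x))\<^sup>2 \<partial>lborel)" for b
    using nn_integral_lborel_translation[of "\<lambda>x. ennreal ((norm (\<phi> x))\<^sup>2)" "- b"] by simp
  have CS: "(\<integral>\<^sup>+x. norm (h b x) \<partial>lborel)\<^sup>2 \<le> E" for b
    using nn_integral_Cauchy_Schwarz[of "\<lambda>x. norm (f x)" lborel "\<lambda>x. norm (\<phi> (x - b))"] fin
    by (simp add: nh trans E_def)
  have Efin: "E < \<infinity>"
    using fin by (simp add: E_def ennreal_mult_less_top)
  have hint: "integrable lborel (h b)" for b
  proof -
    have "(\<integral>\<^sup>+x. norm (h b x) \<partial>lborel)\<^sup>2 < \<infinity>"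
      using CS Efin by (rule le_less_trans)
    then have "(\<integral>\<^sup>+x. norm (h b x) \<partial>lborel) < \<infinity>"
      by (simp add: power_less_top_ennreal)
    then show ?thesis by (simp add: integrable_iff_bounded)
  qed
  show Gm: "G \<in> borel_measurable borel"
  proof -
    have "(\<lambda>(z, x). exp (- (2 * pi * (x $ 1) * (fst z $ 1)) *\<^sub>R quat_i) * (f x * quat_cnj (\<phi> (x - snd z))) *
       exp (- (2 * pi * (x $ 2) * (fst z $ 2)) *\<^sub>R quat_j)) \<in> borel_measurable ((borel :: ((real^2) \<times> (real^2)) measure) \<Otimes>\<^sub>M lborel)"
      by measurable
    from lborel.borel_measurable_lebesgue_integral[OF this] show ?thesis
      by (simp add: G_def qft_def)
  qed
  show "ennreal ((norm (G z))\<^sup>2) \<le> E"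
  proof -
    obtain \<omega> b where z: "z = (\<omega>, b)" by (cases z)
    let ?F = "\<lambda>x. exp (- (2 * pi * (x $ 1) * (\<omega> $ 1)) *\<^sub>R quat_i) * h b x *
       exp (- (2 * pi * (x $ 2) * (\<omega> $ 2)) *\<^sub>R quat_j)"
    have nF: "norm (?F x) = norm (h b x)" for x
      by (simp add: norm_mult del: scaleR_minus_left)
    have Fi: "integrable lborel ?F"
    proof (rule Bochner_Integration.integrable_bound[OF hint[of b]])
      show "?F \<in> borel_measurable lborel" by measurable
    qed (simp only: nF, simp)
    have "ennreal (norm (G z)) \<le> (\<integral>\<^sup>+x. norm (?F x) \<partial>lborel)"
      using integral_norm_bound_ennreal[OF Fi] by (simp only: z G qft_def)
    also have "\<dots> = (\<integral>\<^sup>+x. norm (h b x) \<partial>lborel)"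
      by (simp only: nF)
    finally have "(ennreal (norm (G z)))\<^sup>2 \<le> (\<integral>\<^sup>+x. norm (h b x) \<partial>lborel)\<^sup>2"
      by (intro power_mono) auto
    then show ?thesis
      using CS[of b] by (simp add: ennreal_power)
  qed
  \<comment> \<open>After exchanging the integrals, the inner one is a reflected copy of the squared
    norm of \<open>\<phi>\<close>, for every \<open>x\<close>.\<close>
  have E: "E = (\<integral>\<^sup>+b. \<integral>\<^sup>+x. (norm (h b x))\<^sup>2 \<partial>lborel \<partial>lborel)"
  proof -
    have "(\<integral>\<^sup>+b. \<integral>\<^sup>+x. (norm (h b x))\<^sup>2 \<partial>lborel \<partial>lborel) =
      (\<integral>\<^sup>+b. \<integral>\<^sup>+x. ennreal ((norm (f x))\<^sup>2) * ennreal ((norm (\<phi> (x - b)))\<^sup>2) \<partial>lborel \<partial>lborel)"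
      by (simp add: nh power_mult_distrib ennreal_mult)
    also have "\<dots> = (\<integral>\<^sup>+x. \<integral>\<^sup>+b. ennreal ((norm (f x))\<^sup>2) * ennreal ((norm (\<phi> (x - b)))\<^sup>2) \<partial>lborel \<partial>lborel)"
      by (rule lborel_pair.Fubini'[symmetric]) measurable
    also have "\<dots> = (\<integral>\<^sup>+x. ennreal ((norm (f x))\<^sup>2) * (\<integral>\<^sup>+y. (norm (\<phi> y))\<^sup>2 \<partial>lborel) \<partial>lborel)"
      using nn_integral_lborel_reflect[of "\<lambda>y. ennreal ((norm (\<phi> y))\<^sup>2)"]
      by (simp add: nn_integral_cmult)
    finally show ?thesis
      by (simp add: E_def nn_integral_multc)
  qed
  \<comment> \<open>The Plancherel inequality requires \<open>h b\<close> to be square integrable.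
    As \<open>E\<close> is finite, this holds for almost every \<open>b\<close>.\<close>
  have "AE b in lborel. (\<integral>\<^sup>+x. (norm (h b x))\<^sup>2 \<partial>lborel) \<noteq> \<infinity>"
  proof (rule nn_integral_PInf_AE)
    show "(\<lambda>b. \<integral>\<^sup>+x. (norm (h b x))\<^sup>2 \<partial>lborel) \<in> borel_measurable lborel"
      unfolding h_def by measurable
    show "(\<integral>\<^sup>+b. \<integral>\<^sup>+x. (norm (h b x))\<^sup>2 \<partial>lborel \<partial>lborel) \<noteq> \<infinity>"
      using Efin E by auto
  qed
  then have "AE b in lborel. (\<integral>\<^sup>+x. (norm (h b x))\<^sup>2 \<partial>lborel) \<le> (\<integral>\<^sup>+\<omega>. (norm (G (\<omega>, b)))\<^sup>2 \<partial>lborel)"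
  proof eventually_elim
    case (elim b)
    then show ?case
      unfolding G by (intro qft_bessel hint) (simp add: less_top)
  qed
  then have "E \<le> (\<integral>\<^sup>+b. \<integral>\<^sup>+\<omega>. (norm (G (\<omega>, b)))\<^sup>2 \<partial>lborel \<partial>lborel)"
    unfolding E by (rule nn_integral_mono_AE)
  also have "\<dots> = (\<integral>\<^sup>+z. (norm (G z))\<^sup>2 \<partial>lborel)"
    using Gm by (intro nn_integral_lborel_pair(2)[symmetric]) measurable
  finally show "E \<le> (\<integral>\<^sup>+z. (norm (G z))\<^sup>2 \<partial>lborel)" .
qed

section \<open>The weighted lower bound\<close>

lemma ex_ball_emeasure_le_half:
  "\<exists>r>0. emeasure lborel (ball (0::'a::euclidean_space) r) \<le> ennreal (1 / 2)"
proof -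
  define V where "V = unit_ball_vol (real DIM('a))"
  have V: "V > 0" by (simp add: V_def)
  \<comment> \<open>The radius is at most 1, so \<open>r ^ DIM('a) \<le> r\<close>, and the volume
    is at most \<open>V * r \<le> 1 / 2\<close>.\<close>
  define r where "r = min 1 (1 / (2 * V))"
  have r: "0 < r" "r \<le> 1" "r * V \<le> 1 / 2" 
    using V by (auto simp: r_def min_def field_simps)
  have "r ^ DIM('a) \<le> r ^ 1"
    using r by (intro power_decreasing) (auto simp: Suc_leI)
  then have "V * r ^ DIM('a) \<le> V * r"
    using V by (intro mult_left_mono) auto
  also have "\<dots> \<le> 1 / 2"
    using r by (simp add: mult.commute)
  finally have "V * r ^ DIM('a) \<le> 1 / 2" .
  then have "ennreal (V * r ^ DIM('a)) \<le> ennreal (1 / 2)"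
    by (rule ennreal_leI)
  moreover have "emeasure lborel (ball (0::'a) r) = ennreal (V * r ^ DIM('a))"
    using r by (simp add: emeasure_ball V_def)
  ultimately have "emeasure lborel (ball (0::'a) r) \<le> ennreal (1 / 2)"
    by simp
  with r show ?thesis by blast
qed

text \<open>Inside the ball \<open>g\<close> is at most \<open>E\<close>, outside it the weight is
  at least \<open>r powr t\<close>. Integration yields \<open>E \<le> E / 2 + ?J / r powr t\<close>,
  and absorbing the half doubles the constant.\<close>

lemma weighted_nn_integral_lower_bound:
  fixes g :: "'a::euclidean_space \<Rightarrow> real"
  assumes [measurable]: "g \<in> borel_measurable borel" and g: "\<And>z. 0 \<le> g z" "\<And>z. ennreal (g z) \<le> E"
    and E: "E \<le> (\<integral>\<^sup>+z. g z \<partial>lborel)" "E < \<infinity>"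
    and r: "0 < r" "emeasure lborel (ball (0::'a) r) \<le> ennreal (1 / 2)" and t: "0 \<le> t"
  shows "E \<le> ennreal (2 / r powr t) * (\<integral>\<^sup>+z. ennreal (norm z powr t * g z) \<partial>lborel)"
proof -
  let ?J = "\<integral>\<^sup>+z. ennreal (norm z powr t * g z) \<partial>lborel"
  have [measurable]: "ball (0::'a) r \<in> sets borel" by simp
  have pt: "ennreal (g z) \<le> E * indicator (ball 0 r) z + ennreal (1 / r powr t) * ennreal (norm z powr t * g z)" for z
  proof (cases "z \<in> ball 0 r")
    case False
    then have "r powr t \<le> norm z powr t"
      using r t by (intro powr_mono2) auto
    then have "g z \<le> 1 / r powr t * (norm z powr t * g z)"
      using r g(1)[of z] mult_right_mono[of "r powr t" "norm z powr t" "g z"] by (simp add: field_simps)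
    then show ?thesis
      using r False by (simp add: ennreal_mult[symmetric] g ennreal_leI)
  qed (use g(2)[of z] in \<open>auto intro: order_trans\<close>)
  have "E \<le> (\<integral>\<^sup>+z. E * indicator (ball 0 r) z + ennreal (1 / r powr t) * ennreal (norm z powr t * g z) \<partial>lborel)"
    using E(1) nn_integral_mono[of lborel, OF pt] by (rule order_trans)
  also have "\<dots> = E * emeasure lborel (ball (0::'a) r) + ennreal (1 / r powr t) * ?J"
    by (subst nn_integral_add) (simp_all add: nn_integral_cmult nn_integral_cmult_indicator)
  also have "\<dots> \<le> E * ennreal (1 / 2) + ennreal (1 / r powr t) * ?J"
    by (intro add_right_mono mult_left_mono r) simp
  finally have le: "E \<le> E * ennreal (1 / 2) + ennreal (1 / r powr t) * ?J" .
  show ?thesis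
  proof (cases "?J = \<infinity>")
    case True
    then show ?thesis using r by (simp add: ennreal_mult_top)
  next
    case False
    \<comment> \<open>Finiteness of \<open>E\<close> is what allows half of it to be subtracted, now
      among real numbers.\<close>
    obtain e j where e: "E = ennreal e" "0 \<le> e" and j: "?J = ennreal j" "0 \<le> j"
      using E(2) False unfolding infinity_ennreal_def less_top less_top_ennreal by blast
    have "ennreal (e * c + k * j) = ennreal e * ennreal c + ennreal k * ennreal j" if "0 \<le> c" "0 \<le> k" for c k
      using that e j by (simp add: ennreal_mult)
    from this[of "1 / 2" "1 / r powr t"] have "ennreal e \<le> ennreal (e * (1 / 2) + 1 / r powr t * j)"
      using le[unfolded e(1) j(1)] r by simp
    then have "e \<le> e * (1 / 2) + 1 / r powr t * j"
      using e j by (subst (asm) ennreal_le_iff) auto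
    then have "e \<le> 2 / r powr t * j" by simp
    then show ?thesis
      using e j by (simp add: ennreal_mult[symmetric] ennreal_leI)
  qed
qed

lemma L2_iff: "f \<in> L2 \<longleftrightarrow> f \<in> borel_measurable lebesgue \<and> (\<integral>\<^sup>+x. (norm (f x))\<^sup>2 \<partial>lborel) < \<infinity>"
  by (simp add: L2_def L2_norm_def ennreal_sqrt_def nn_integral_completion less_top)

lemma ennreal_sqrt_mult_le:
  assumes "a < \<infinity>" "b < \<infinity>" "a * b \<le> ennreal K * J" "K > 0"
  shows "ennreal_sqrt a * ennreal_sqrt b \<le> ennreal (sqrt K) * ennreal_sqrt J"
proof (cases "J = \<infinity>")
  case True
  then show ?thesis using assms by (simp add: ennreal_sqrt_def ennreal_mult_top)
next
  case False
  obtain a' b' j where a: "a = ennreal a'" "0 \<le> a'" and b: "b = ennreal b'" "0 \<le> b'" and j: "J = ennreal j" "0 \<le> j"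
    using assms(1,2) False unfolding infinity_ennreal_def less_top less_top_ennreal by blast
  have "a' * b' \<le> K * j"
    using assms a b j by (simp add: ennreal_mult[symmetric])
  then show ?thesis
    using assms a b j by (simp add: ennreal_sqrt_def ennreal_mult[symmetric] real_sqrt_mult[symmetric] ennreal_leI)
qed

theorem theorem4p5:
  fixes s :: real
  assumes "s > 0"
  shows "\<exists>C::real. C > 0 \<and> (\<forall>f\<in>L2. \<forall>\<phi>\<in>L2.
    L2_norm f * L2_norm \<phi> \<le> ennreal C *
      ennreal_sqrt (\<integral>\<^sup>+z. ennreal (norm z powr (2 * s) * (norm (gqft \<phi> f z))\<^sup>2) \<partial>lebesgue))"
proof -
  \<comment> \<open>Both \<open>r\<close> and \<open>K\<close> are fixed before \<open>f\<close> and
    \<open>\<phi>\<close> appear, so the constant is uniform in them.\<close>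
  obtain r where r: "r > 0" "emeasure lborel (ball (0 :: (real^2) \<times> (real^2)) r) \<le> ennreal (1 / 2)"
    using ex_ball_emeasure_le_half by blast
  define K where "K = 2 / r powr (2 * s)"
  have K: "K > 0" using r by (simp add: K_def)
  have "L2_norm f * L2_norm \<phi> \<le> ennreal (sqrt K) *
      ennreal_sqrt (\<integral>\<^sup>+z. ennreal (norm z powr (2 * s) * (norm (gqft \<phi> f z))\<^sup>2) \<partial>lebesgue)"
    if "f \<in> L2" "\<phi> \<in> L2" for f \<phi>
  proof -
    have "f \<in> borel_measurable lebesgue" "\<phi> \<in> borel_measurable lebesgue"
      using that by (simp_all add: L2_iff)
    then obtain f' \<phi>' where f': "f' \<in> borel_measurable borel" "AE x in lborel. f x = f' x"
      and \<phi>': "\<phi>' \<in> borel_measurable borel" "AE x in lborel. \<phi> x = \<phi>' x"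
      by (elim lebesgue_ex_borel_measurable)
    have nf: "(\<integral>\<^sup>+x. (norm (f x))\<^sup>2 \<partial>lborel) = (\<integral>\<^sup>+x. (norm (f' x))\<^sup>2 \<partial>lborel)"
      using f'(2) by (intro nn_integral_cong_AE) auto
    have n\<phi>: "(\<integral>\<^sup>+x. (norm (\<phi> x))\<^sup>2 \<partial>lborel) = (\<integral>\<^sup>+x. (norm (\<phi>' x))\<^sup>2 \<partial>lborel)"
      using \<phi>'(2) by (intro nn_integral_cong_AE) auto
    have fin: "(\<integral>\<^sup>+x. (norm (f' x))\<^sup>2 \<partial>lborel) < \<infinity>" "(\<integral>\<^sup>+x. (norm (\<phi>' x))\<^sup>2 \<partial>lborel) < \<infinity>"
      using that by (simp_all add: L2_iff nf n\<phi>)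
    define G where "G z = qft (\<lambda>x. f' x * quat_cnj (\<phi>' (x - snd z))) (fst z)" for z
    \<comment> \<open>The equality is pointwise, so the weighted integrands agree everywhere and the
      Borel measurability of \<open>G\<close> carries over.\<close>
    have G: "gqft \<phi> f z = G z" for z
      using gqft_eq_qft[OF _ f' \<phi>', of "fst z" "snd z"] that by (simp add: G_def L2_iff)
    note win = qft_window[OF f'(1) \<phi>'(1) fin, folded G_def]
    \<comment> \<open>The lower bound is taken with \<open>g z = (norm (G z))\<^sup>2\<close> and
      exponent \<open>t = 2 * s\<close>.\<close>
    have "(\<integral>\<^sup>+x. (norm (f' x))\<^sup>2 \<partial>lborel) * (\<integral>\<^sup>+x. (norm (\<phi>' x))\<^sup>2 \<partial>lborel)
      \<le> ennreal K * (\<integral>\<^sup>+z. ennreal (norm z powr (2 * s) * (norm (G z))\<^sup>2) \<partial>lborel)"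
      unfolding K_def
      using win fin assms r
      by (intro weighted_nn_integral_lower_bound) (auto simp: ennreal_mult_less_top)
    from ennreal_sqrt_mult_le[OF fin this K] show ?thesis
      by (simp add: L2_norm_def nn_integral_completion nf n\<phi> G)
  qed
  with K show ?thesis
    by (intro exI[of _ "sqrt K"]) auto
qed

end
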